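(* Let $f:\mathbb{R}\to\mathbb{R}$ be a smooth function with $f\ge 0$, $f'\le 0$ and $f''\ge 0$, and let $\mathbb{R}\times_f\mathbb{R}^2$ denote $\mathbb{R}\times\mathbb{R}^2$ with the Riemannian metric $dt^2+e^{2f(t)}(dx^2+dy^2)$. Let $\Sigma$ be a compact graph over a domain of $\mathbb{R}^2$ in $\mathbb{R}\times_f\mathbb{R}^2$. Suppose that $\Sigma$ has positive constant extrinsic curvature $K_e$ and that its boundary $\partial\Sigma$ is contained in the slice $\{0\}\times\mathbb{R}^2$. Then the height function $h:\Sigma\to\mathbb{R}$ satisfies $$h(p)\le \frac{e^{f(0)}}{\sqrt{K_e}}\qquad\text{for every } p\in\Sigma.$$
   Context: Points of $\mathbb{R}\times_f\mathbb{R}^2$ are written $(t,q)$ with $t\in\mathbb{R}$, $q=(x,y)\in\mathbb{R}^2$. A graph over a domain of $\mathbb{R}^2$ is a surface of the form $\{(u(q),q)\}$ with $q$ ranging over the domain; here it is compact, with boundary. The height function is $h=\pi_1|_\Sigma$, where $\pi_1(t,q)=t$. If $N$ is a unit normal field along $\Sigma$ and $\overline\nabla$ is the Levi-Civita connection of the ambient metric, the shape operator $S$ is defined by $\overline\nabla_XN=-SX$, and the extrinsic curvature is $K_e=\det S$ (independent of the choice of $\pm N$). *)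

theory Defs
  imports "HOL-Analysis.Analysis"
begin

text \<open>Smoothness on an open set: all iterated directional derivatives exist as Frechet
  differentiable functions.\<close>

primrec Ck_on :: "nat \<Rightarrow> 'a::euclidean_space set \<Rightarrow> ('a \<Rightarrow> 'b::real_normed_vector) \<Rightarrow> bool" where
  "Ck_on 0 U F \<longleftrightarrow> continuous_on U F"
| "Ck_on (Suc k) U F \<longleftrightarrow>
     (\<forall>x\<in>U. F differentiable (at x)) \<and> (\<forall>v. Ck_on k U (\<lambda>x. frechet_derivative F (at x) v))"

definition smooth_on :: "'a::euclidean_space set \<Rightarrow> ('a \<Rightarrow> 'b::real_normed_vector) \<Rightarrow> bool" where
  "smooth_on U F \<longleftrightarrow> (\<forall>k. Ck_on k U F)"

text \<open>The ambient manifold is a vector space \<open>'a\<close>, covered by one chart, and a metric assigns to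
  each point a bilinear form on \<open>'a\<close>. Every affine connection on it is
  \<open>\<nabla>\<^sub>X Y = D\<^sub>X Y + \<Gamma>(X, Y)\<close> with \<open>\<Gamma>\<close> bilinear at each point (the Christoffel symbols). Vanishing
  torsion means that \<open>\<Gamma>\<close> is symmetric; compatibility with the metric only has to be required on
  constant vector fields \<open>Y\<close>, \<open>Z\<close>, for which \<open>\<nabla>\<^sub>X Y = \<Gamma>(X, Y)\<close>.\<close>

type_synonym 'a metric_tensor = "'a \<Rightarrow> 'a \<Rightarrow> 'a \<Rightarrow> real"

definition is_levi_civita ::
    "'a::euclidean_space metric_tensor \<Rightarrow> ('a \<Rightarrow> 'a \<Rightarrow> 'a \<Rightarrow> 'a) \<Rightarrow> bool" where
  "is_levi_civita g \<Gamma> \<longleftrightarrow>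
     (\<forall>p. bilinear (\<Gamma> p)) \<and>
     (\<forall>p X Y. \<Gamma> p X Y = \<Gamma> p Y X) \<and>
     (\<forall>p X Y Z. frechet_derivative (\<lambda>p'. g p' Y Z) (at p) X
                  = g p (\<Gamma> p X Y) Z + g p Y (\<Gamma> p X Z))"

definition levi_civita ::
    "'a::euclidean_space metric_tensor \<Rightarrow> 'a \<Rightarrow> 'a \<Rightarrow> 'a \<Rightarrow> 'a" where
  "levi_civita g = (THE \<Gamma>. is_levi_civita g \<Gamma>)"

text \<open>For a field \<open>N\<close> along an immersion \<open>\<phi>\<close>, the covariant derivative of \<open>N\<close> at \<open>q\<close> in the
  direction of the tangent vector \<open>d\<phi>\<^sub>q v\<close>.\<close>

definition cov_deriv_along ::
    "'a::euclidean_space metric_tensor \<Rightarrow> ('m::euclidean_space \<Rightarrow> 'a) \<Rightarrow> ('m \<Rightarrow> 'a) \<Rightarrow> 'm \<Rightarrow> 'm \<Rightarrow> 'a"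
  where
  "cov_deriv_along g \<phi> N q v =
     frechet_derivative N (at q) v
       + levi_civita g (\<phi> q) (frechet_derivative \<phi> (at q) v) (N q)"

definition unit_normal_field ::
    "'a::euclidean_space metric_tensor \<Rightarrow> ('m::euclidean_space \<Rightarrow> 'a) \<Rightarrow> 'm set \<Rightarrow> ('m \<Rightarrow> 'a) \<Rightarrow> bool"
  where
  "unit_normal_field g \<phi> U N \<longleftrightarrow>
     smooth_on U N \<and>
     (\<forall>q\<in>U. g (\<phi> q) (N q) (N q) = 1 \<and>
            (\<forall>v. g (\<phi> q) (frechet_derivative \<phi> (at q) v) (N q) = 0))"

text \<open>The shape operator is pulled back to the parameter space by the isomorphism \<open>d\<phi>\<^sub>q\<close> onto the
  tangent space of the surface. This conjugation does not change its determinant.\<close>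

definition shape_operator ::
    "'a::euclidean_space metric_tensor \<Rightarrow> ('m::euclidean_space \<Rightarrow> 'a) \<Rightarrow> ('m \<Rightarrow> 'a) \<Rightarrow> 'm \<Rightarrow> 'm \<Rightarrow> 'm"
  where
  "shape_operator g \<phi> N q =
     (THE S. linear S \<and>
        (\<forall>v. cov_deriv_along g \<phi> N q v = - frechet_derivative \<phi> (at q) (S v)))"

definition extrinsic_curvature ::
    "'a::euclidean_space metric_tensor \<Rightarrow> (real^2 \<Rightarrow> 'a) \<Rightarrow> (real^2 \<Rightarrow> 'a) \<Rightarrow> real^2 \<Rightarrow> real" where
  "extrinsic_curvature g \<phi> N q = det (matrix (shape_operator g \<phi> N q))"

definition warped_metric :: "(real \<Rightarrow> real) \<Rightarrow> (real \<times> (real^2)) metric_tensor" where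
  "warped_metric f = (\<lambda>(t, q) (a, v) (b, w). a * b + exp (2 * f t) * (v \<bullet> w))"

definition graph_map :: "(real^2 \<Rightarrow> real) \<Rightarrow> real^2 \<Rightarrow> real \<times> (real^2)" where
  "graph_map u q = (u q, q)"

definition height :: "real \<times> (real^2) \<Rightarrow> real" where
  "height p = fst p"

text \<open>A compact graph with boundary over the closed domain \<open>D\<close>. Its boundary is the part lying
  over \<open>frontier D\<close>. Smoothness of \<open>u\<close> is demanded only over the interior, since a smooth
  compact surface may have vertical tangent planes along its boundary, as a hemisphere does.\<close>

definition compact_graph :: "(real^2) set \<Rightarrow> (real^2 \<Rightarrow> real) \<Rightarrow> bool" where
  "compact_graph D u \<longleftrightarrow>
     connected (interior D) \<and> D = closure (interior D) \<and>
     continuous_on D u \<and> smooth_on (interior D) u \<and>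
     compact (graph_map u ` D)"

definition graph_boundary :: "(real^2) set \<Rightarrow> (real^2 \<Rightarrow> real) \<Rightarrow> (real \<times> (real^2)) set" where
  "graph_boundary D u = graph_map u ` frontier D"

text \<open>Existence and uniqueness of the Levi-Civita connection of the warped metric.\<close>

lemma is_levi_civita_unique:
  fixes g :: "'a::euclidean_space metric_tensor"
  assumes sym: "\<And>p X Y. g p X Y = g p Y X"
    and nondeg: "\<And>p V W. (\<And>Z. g p V Z = g p W Z) \<Longrightarrow> V = W"
    and A: "is_levi_civita g A" and B: "is_levi_civita g B"
  shows "A = B"
proof (intro ext)
  fix p X Y
  have koszul: "2 * g p (C p X Y) Z = frechet_derivative (\<lambda>p'. g p' Y Z) (at p) X
      + frechet_derivative (\<lambda>p'. g p' X Z) (at p) Y - frechet_derivative (\<lambda>p'. g p' X Y) (at p) Z"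
    if C: "is_levi_civita g C" for C Z
  proof -
    have s: "C p X Y = C p Y X" "C p X Z = C p Z X" "C p Y Z = C p Z Y"
      using C by (auto simp: is_levi_civita_def)
    have c: "frechet_derivative (\<lambda>p'. g p' V W) (at p) U = g p (C p U V) W + g p V (C p U W)" for U V W
      using C by (auto simp: is_levi_civita_def)
    show ?thesis
      using sym[of p Y "C p X Z"] sym[of p X "C p Y Z"] sym[of p X "C p Z Y"] by (simp add: c s)
  qed
  show "A p X Y = B p X Y"
  proof (rule nondeg)
    fix Z
    show "g p (A p X Y) Z = g p (B p X Y) Z"
      using koszul[OF A, of Z] koszul[OF B, of Z] by simp
  qed
qed

lemma is_levi_civita_warped:
  assumes f: "\<And>t. f differentiable (at t)"
  shows "is_levi_civita (warped_metric f)
    (\<lambda>(t, q) (a, v) (b, w). (- deriv f t * exp (2 * f t) * (v \<bullet> w), deriv f t *\<^sub>R (a *\<^sub>R w + b *\<^sub>R v)))"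
    (is "is_levi_civita _ ?G")
proof -
  have bil: "bilinear (?G p)" for p
    by (cases p) (auto simp: bilinear_def linear_iff algebra_simps inner_add_left inner_add_right
        scaleR_add_right scaleR_add_left)
  have symm: "?G p X Y = ?G p Y X" for p X Y
    by (cases p; cases X; cases Y) (simp add: inner_commute add.commute)
  have comp: "frechet_derivative (\<lambda>p'. warped_metric f p' Y Z) (at p) X
      = warped_metric f p (?G p X Y) Z + warped_metric f p Y (?G p X Z)" for p X Y Z
  proof -
    obtain t q where p: "p = (t, q)" by fastforce
    obtain a x where X: "X = (a, x)" by fastforce
    obtain b v where Y: "Y = (b, v)" by fastforce
    obtain c w where Z: "Z = (c, w)" by fastforce
    have "(f has_field_derivative deriv f t) (at t)"
      using f[of t] by (simp add: DERIV_deriv_iff_real_differentiable)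
    hence df: "(f has_derivative (*) (deriv f t)) (at (fst p))"
      by (simp add: has_field_derivative_def p)
    have "((\<lambda>p'. f (fst p')) has_derivative (\<lambda>V. deriv f t * fst V)) (at p)"
      by (rule has_derivative_compose[OF has_derivative_fst[OF has_derivative_ident] df])
    hence "((\<lambda>p'. b * c + exp (2 * f (fst p')) * (v \<bullet> w)) has_derivative
        (\<lambda>V. exp (2 * f t) * (2 * (deriv f t * fst V)) * (v \<bullet> w))) (at p)"
      by (auto intro!: derivative_eq_intros simp: p)
    moreover have "(\<lambda>p'. warped_metric f p' Y Z) = (\<lambda>p'. b * c + exp (2 * f (fst p')) * (v \<bullet> w))"
      by (auto simp: warped_metric_def Y Z)
    ultimately have "frechet_derivative (\<lambda>p'. warped_metric f p' Y Z) (at p) X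
        = exp (2 * f t) * (2 * (deriv f t * a)) * (v \<bullet> w)"
      by (simp add: frechet_derivative_at[symmetric] X)
    also have "\<dots> = warped_metric f p (?G p X Y) Z + warped_metric f p Y (?G p X Z)"
      by (simp add: warped_metric_def p X Y Z inner_add_left inner_add_right algebra_simps inner_commute)
    finally show ?thesis .
  qed
  show ?thesis
    unfolding is_levi_civita_def using bil symm comp by blast
qed

lemma levi_civita_warped:
  assumes f: "\<And>t. f differentiable (at t)"
  shows "levi_civita (warped_metric f) =
    (\<lambda>(t, q) (a, v) (b, w). (- deriv f t * exp (2 * f t) * (v \<bullet> w), deriv f t *\<^sub>R (a *\<^sub>R w + b *\<^sub>R v)))"
  unfolding levi_civita_def
proof (rule the_equality)
  show "is_levi_civita (warped_metric f)
    (\<lambda>(t, q) (a, v) (b, w). (- deriv f t * exp (2 * f t) * (v \<bullet> w), deriv f t *\<^sub>R (a *\<^sub>R w + b *\<^sub>R v)))"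
    by (rule is_levi_civita_warped[OF f])
next
  fix \<Gamma> assume G: "is_levi_civita (warped_metric f) \<Gamma>"
  have sym: "warped_metric f p X Y = warped_metric f p Y X" for p X Y
    by (cases p; cases X; cases Y) (simp add: warped_metric_def inner_commute)
  have nondeg: "V = W" if h: "\<And>Z. warped_metric f p V Z = warped_metric f p W Z" for p V W
  proof (cases p; cases V; cases W)
    fix t q a v b w assume e: "p = (t, q)" "V = (a, v)" "W = (b, w)"
    have "a = b"
      using h[of "(1, 0)"] by (simp add: warped_metric_def e)
    moreover have "v \<bullet> z = w \<bullet> z" for z
      using h[of "(0, z)"] by (simp add: warped_metric_def e)
    hence "v = w" by (metis vector_eq_ldot inner_commute)
    ultimately show ?thesis by (simp add: e)
  qed
  show "\<Gamma> = (\<lambda>(t, q) (a, v) (b, w).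
      (- deriv f t * exp (2 * f t) * (v \<bullet> w), deriv f t *\<^sub>R (a *\<^sub>R w + b *\<^sub>R v)))"
    by (rule is_levi_civita_unique[OF sym nondeg G is_levi_civita_warped[OF f]])
qed

end

theory Submission
  imports Defs
begin

text \<open>Write \<open>c = sqrt Ke\<close>, let \<open>\<nu>\<close> be the product of the unit normal with \<open>\<partial>\<^sub>t\<close>, and let \<open>G\<close> be the
  antiderivative of \<open>exp \<circ> f\<close> vanishing at some \<open>t0 \<ge> 0\<close>. For \<open>0 < \<lambda> < 1\<close> the function
  \<open>\<lambda> c G(h) - e\<^sup>f \<bar>\<nu>\<bar>\<close> has no interior maximum at a height where \<open>\<bar>f'\<bar> \<le> c\<close>: at a critical point where the
  tangent plane is not horizontal, \<open>\<nabla>h\<close> is a principal direction with curvature \<open>\<lambda> c\<close>, so both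
  principal curvatures are known, and the second fundamental form trace of the Hessian, computed with
  the Codazzi equation and constancy of \<open>Ke\<close>, has a strict sign; where the tangent plane is horizontal,
  the sign follows from \<open>\<bar>f'\<bar> \<le> c\<close>.

  If \<open>\<bar>f'\<bar> \<ge> c\<close> at the maximal height \<open>m\<close>, convexity and \<open>f \<ge> 0\<close> give \<open>c m \<le> f 0 \<le> exp (f 0)\<close>. Otherwise the
  second fundamental form is definite with the sign of a cap. Take \<open>t0\<close> to be \<open>0\<close> if \<open>\<bar>f' 0\<bar> \<le> c\<close>, and else with
  \<open>\<bar>f' t0\<bar> = c\<close>. The maximum principle yields \<open>\<lambda> c G m \<le> exp (f m)\<close>, hence \<open>c (m - t0) \<le> 1\<close> as \<open>\<lambda>\<close> tends to \<open>1\<close>, and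
  convexity gives \<open>1 + c t0 \<le> exp (f 0)\<close>.\<close>

section \<open>Consequences of smoothness\<close>

lemma smooth_on_differentiable:
  assumes "smooth_on U F" "x \<in> U"
  shows "F differentiable (at x)"
proof -
  have "Ck_on (Suc 0) U F" using assms(1) unfolding smooth_on_def by blast
  then show ?thesis using assms(2) by simp
qed

lemma smooth_on_frechet_derivative:
  assumes "smooth_on U F"
  shows "smooth_on U (\<lambda>x. frechet_derivative F (at x) v)"
  unfolding smooth_on_def
proof
  fix k
  have "Ck_on (Suc k) U F" using assms unfolding smooth_on_def by blast
  then show "Ck_on k U (\<lambda>x. frechet_derivative F (at x) v)" by simp
qed

lemma smooth_on_continuous_on:
  assumes "smooth_on U F"
  shows "continuous_on U F"
proof -
  have "Ck_on 0 U F" using assms unfolding smooth_on_def by blast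
  then show ?thesis by simp
qed

text \<open>Trades iterated Frechet derivatives for \<open>deriv\<close>, in which the sign
  conditions on \<open>f\<close> are phrased.\<close>

lemma smooth_on_DERIV:
  fixes f :: "real \<Rightarrow> real"
  assumes "smooth_on UNIV f"
  shows "DERIV f t :> deriv f t" "smooth_on UNIV (deriv f)"
proof -
  have d: "(f has_derivative frechet_derivative f (at t)) (at t)" for t
    using smooth_on_differentiable[OF assms] by (simp add: frechet_derivative_works)
  have D: "DERIV f t :> frechet_derivative f (at t) 1" for t
  proof -
    have "frechet_derivative f (at t) = (*) (frechet_derivative f (at t) 1)"
      using linear_times_of_real linear_frechet_derivative[OF smooth_on_differentiable[OF assms, of t]]
      by (metis (no_types, lifting) ext UNIV_I linear_cmul mult.commute mult.right_neutral real_scaleR_def)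
    then show ?thesis using d[of t] unfolding has_field_derivative_def by simp
  qed
  then have e: "deriv f t = frechet_derivative f (at t) 1" for t
    by (rule DERIV_imp_deriv)
  show "DERIV f t :> deriv f t" using D e by simp
  have "deriv f = (\<lambda>t. frechet_derivative f (at t) 1)" using e by auto
  then show "smooth_on UNIV (deriv f)"
    using smooth_on_frechet_derivative[OF assms, of 1] by simp
qed

section \<open>Symmetry of mixed directional derivatives\<close>

text \<open>The mean value theorem is applied twice: along \<open>v\<close> to the increment of
  \<open>F\<close> in direction \<open>w\<close>, then along \<open>w\<close> to
  \<open>Fv\<close>.\<close>

lemma second_difference:
  fixes F :: "'a::real_normed_vector \<Rightarrow> real"
  assumes h: "h > 0"
    and U: "\<And>s t. s \<in> {0..h} \<Longrightarrow> t \<in> {0..h} \<Longrightarrow> x + s *\<^sub>R v + t *\<^sub>R w \<in> U"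
    and Fv: "\<And>q. q \<in> U \<Longrightarrow> ((\<lambda>s. F (q + s *\<^sub>R v)) has_real_derivative Fv q) (at 0)"
    and Fvw: "\<And>q. q \<in> U \<Longrightarrow> ((\<lambda>s. Fv (q + s *\<^sub>R w)) has_real_derivative Fvw q) (at 0)"
  shows "\<exists>s\<in>{0..h}. \<exists>t\<in>{0..h}. F (x + h *\<^sub>R v + h *\<^sub>R w) - F (x + h *\<^sub>R v) - F (x + h *\<^sub>R w) + F x
           = h\<^sup>2 * Fvw (x + s *\<^sub>R v + t *\<^sub>R w)"
proof -
  \<comment> \<open>The hypotheses differentiate at parameter 0 from a moving base point; the mean
    value theorem needs the derivative at parameter \<open>s\<close> along one fixed line.\<close>
  have shift: "((\<lambda>s. G (q + s *\<^sub>R z)) has_real_derivative d) (at s)"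
    if "((\<lambda>r. G ((q + s *\<^sub>R z) + r *\<^sub>R z)) has_real_derivative d) (at 0)" for G :: "'a \<Rightarrow> real" and q z d s
  proof -
    have "((\<lambda>r. G (q + (r + s) *\<^sub>R z)) has_real_derivative d) (at 0)"
      using that by (simp add: algebra_simps)
    then show ?thesis using DERIV_shift[of "\<lambda>r. G (q + r *\<^sub>R z)" d 0 s] by simp
  qed
  define A where "A s = F ((x + h *\<^sub>R w) + s *\<^sub>R v) - F (x + s *\<^sub>R v)" for s
  have "\<exists>s. 0 < s \<and> s < h \<and> A h - A 0 = (h - 0) * (Fv ((x + h *\<^sub>R w) + s *\<^sub>R v) - Fv (x + s *\<^sub>R v))"
  proof (rule MVT2[OF h])
    fix s :: real assume s: "0 \<le> s" "s \<le> h"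
    have "(x + h *\<^sub>R w) + s *\<^sub>R v \<in> U" "x + s *\<^sub>R v \<in> U"
      using U[of s h] U[of s 0] s h by (auto simp: algebra_simps)
    from Fv[OF this(1), THEN shift] Fv[OF this(2), THEN shift]
    show "(A has_real_derivative Fv ((x + h *\<^sub>R w) + s *\<^sub>R v) - Fv (x + s *\<^sub>R v)) (at s)"
      unfolding A_def by (rule DERIV_diff)
  qed
  then obtain s where s: "0 < s" "s < h"
    and As: "A h - A 0 = h * (Fv ((x + h *\<^sub>R w) + s *\<^sub>R v) - Fv (x + s *\<^sub>R v))" by auto
  have "\<exists>t. 0 < t \<and> t < h \<and> Fv (x + s *\<^sub>R v + h *\<^sub>R w) - Fv (x + s *\<^sub>R v + 0 *\<^sub>R w)
      = (h - 0) * Fvw (x + s *\<^sub>R v + t *\<^sub>R w)"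
  proof (rule MVT2[OF h, where f = "\<lambda>t. Fv (x + s *\<^sub>R v + t *\<^sub>R w)"])
    fix t :: real assume "0 \<le> t" "t \<le> h"
    then have "x + s *\<^sub>R v + t *\<^sub>R w \<in> U" using s U by simp
    from shift[OF Fvw[OF this]]
    show "((\<lambda>t. Fv (x + s *\<^sub>R v + t *\<^sub>R w)) has_real_derivative Fvw (x + s *\<^sub>R v + t *\<^sub>R w)) (at t)" .
  qed
  then obtain t where t: "0 < t" "t < h"
    and Bt: "Fv (x + s *\<^sub>R v + h *\<^sub>R w) - Fv (x + s *\<^sub>R v) = h * Fvw (x + s *\<^sub>R v + t *\<^sub>R w)" by auto
  have "A h - A 0 = h\<^sup>2 * Fvw (x + s *\<^sub>R v + t *\<^sub>R w)"
    unfolding As using Bt by (simp add: power2_eq_square add_ac)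
  moreover have "A h - A 0 = F (x + h *\<^sub>R v + h *\<^sub>R w) - F (x + h *\<^sub>R v) - F (x + h *\<^sub>R w) + F x"
    by (simp add: A_def add_ac)
  ultimately show ?thesis using s t by (intro bexI[of _ s] bexI[of _ t]) auto
qed

text \<open>The second difference over a parallelogram is symmetric in \<open>v\<close> and
  \<open>w\<close>, so it is \<open>h^2\<close> times a value of \<open>Fvw\<close> and also
  \<open>h^2\<close> times a value of \<open>Fwv\<close>, both taken close to \<open>x\<close>.
  Continuity carries the equality to \<open>x\<close>.\<close>

lemma mixed_derivatives_commute:
  fixes F :: "'a::real_normed_vector \<Rightarrow> real"
  assumes "open U" "x \<in> U"
    and Fv: "\<And>q. q \<in> U \<Longrightarrow> ((\<lambda>s. F (q + s *\<^sub>R v)) has_real_derivative Fv q) (at 0)"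
    and Fw: "\<And>q. q \<in> U \<Longrightarrow> ((\<lambda>s. F (q + s *\<^sub>R w)) has_real_derivative Fw q) (at 0)"
    and Fvw: "\<And>q. q \<in> U \<Longrightarrow> ((\<lambda>s. Fv (q + s *\<^sub>R w)) has_real_derivative Fvw q) (at 0)"
    and Fwv: "\<And>q. q \<in> U \<Longrightarrow> ((\<lambda>s. Fw (q + s *\<^sub>R v)) has_real_derivative Fwv q) (at 0)"
    and cont: "continuous_on U Fvw" "continuous_on U Fwv"
  shows "Fvw x = Fwv x"
proof -
  have "dist (Fvw x) (Fwv x) < e" if e: "e > 0" for e
  proof -
    obtain d0 where d0: "d0 > 0" "ball x d0 \<subseteq> U" using assms(1,2) openE by blast
    have "isCont Fvw x" "isCont Fwv x"
      using cont assms(1,2) continuous_on_eq_continuous_at by blast+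
    then obtain d1 d2 where d1: "d1 > 0" "\<And>y. dist y x < d1 \<Longrightarrow> dist (Fvw y) (Fvw x) < e / 2"
      and d2: "d2 > 0" "\<And>y. dist y x < d2 \<Longrightarrow> dist (Fwv y) (Fwv x) < e / 2"
      unfolding continuous_at_eps_delta using e by (metis half_gt_zero)
    define d where "d = Min {d0, d1, d2}"
    have d: "d > 0" "d \<le> d0" "d \<le> d1" "d \<le> d2" using d0 d1 d2 by (auto simp: d_def)
    \<comment> \<open>This side length keeps the whole parallelogram within distance
      \<open>d\<close> of \<open>x\<close>; the summand 1 keeps the denominator positive when both
      vectors vanish.\<close>
    define h where "h = d / (norm v + norm w + 1)"
    have nz: "norm v + norm w + 1 > 0" by (simp add: add_nonneg_pos)
    have h: "h > 0" using d nz by (simp add: h_def)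
    have near: "dist (x + s *\<^sub>R v + t *\<^sub>R w) x < d" if "s \<in> {0..h}" "t \<in> {0..h}" for s t
    proof -
      have "dist (x + s *\<^sub>R v + t *\<^sub>R w) x = norm (s *\<^sub>R v + t *\<^sub>R w)" by (simp add: dist_norm)
      also have "\<dots> \<le> s * norm v + t * norm w"
        using that norm_triangle_ineq[of "s *\<^sub>R v" "t *\<^sub>R w"] by simp
      also have "\<dots> \<le> h * norm v + h * norm w"
        using that by (intro add_mono mult_right_mono) auto
      also have "\<dots> < h * (norm v + norm w + 1)" using h by (simp add: algebra_simps)
      also have "\<dots> = d" using nz by (simp add: h_def)
      finally show ?thesis .
    qed
    have inU: "x + s *\<^sub>R v + t *\<^sub>R w \<in> U" if "s \<in> {0..h}" "t \<in> {0..h}" for s t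
      using near[OF that] d d0 by (auto simp: dist_commute)
    obtain s t where st: "s \<in> {0..h}" "t \<in> {0..h}"
      "F (x + h *\<^sub>R v + h *\<^sub>R w) - F (x + h *\<^sub>R v) - F (x + h *\<^sub>R w) + F x = h\<^sup>2 * Fvw (x + s *\<^sub>R v + t *\<^sub>R w)"
      using second_difference[OF h inU Fv Fvw] by blast
    obtain s' t' where st': "s' \<in> {0..h}" "t' \<in> {0..h}"
      "F (x + h *\<^sub>R w + h *\<^sub>R v) - F (x + h *\<^sub>R w) - F (x + h *\<^sub>R v) + F x = h\<^sup>2 * Fwv (x + s' *\<^sub>R w + t' *\<^sub>R v)"
    proof -
      have "x + s *\<^sub>R w + t *\<^sub>R v \<in> U" if "s \<in> {0..h}" "t \<in> {0..h}" for s t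
        using inU[OF that(2,1)] by (simp add: add_ac)
      from second_difference[OF h this Fw Fwv] show ?thesis using that by blast
    qed
    have "h\<^sup>2 * Fvw (x + s *\<^sub>R v + t *\<^sub>R w) = h\<^sup>2 * Fwv (x + t' *\<^sub>R v + s' *\<^sub>R w)"
      unfolding st(3)[symmetric] using st'(3) by (simp add: add_ac)
    then have eq: "Fvw (x + s *\<^sub>R v + t *\<^sub>R w) = Fwv (x + t' *\<^sub>R v + s' *\<^sub>R w)" using h by simp
    have "dist (Fvw (x + s *\<^sub>R v + t *\<^sub>R w)) (Fvw x) < e / 2"
      using d1(2) near[OF st(1,2)] d by auto
    moreover have "dist (Fwv (x + t' *\<^sub>R v + s' *\<^sub>R w)) (Fwv x) < e / 2"
      using d2(2) near[OF st'(2,1)] d by auto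
    ultimately show ?thesis unfolding eq by (metis dist_triangle_half_r)
  qed
  then show ?thesis by (meson less_irrefl zero_less_dist_iff)
qed

section \<open>Gradients in the plane and the second derivative test\<close>

text \<open>Recording a derivative by its two coefficients turns later differentiation into algebra
  with real numbers.\<close>

abbreviation has_gradient :: "(real^2 \<Rightarrow> real) \<Rightarrow> real \<Rightarrow> real \<Rightarrow> real^2 \<Rightarrow> bool" where
  "has_gradient F a b q \<equiv> (F has_derivative (\<lambda>v. a * v$1 + b * v$2)) (at q)"

abbreviation partial :: "2 \<Rightarrow> (real^2 \<Rightarrow> real) \<Rightarrow> real^2 \<Rightarrow> real" where
  "partial i F \<equiv> \<lambda>q. frechet_derivative F (at q) (axis i 1)"

lemma has_gradient_partial:
  assumes "F differentiable (at q)"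
  shows "has_gradient F (partial 1 F q) (partial 2 F q) q"
proof -
  have "frechet_derivative F (at q) v = partial 1 F q * v$1 + partial 2 F q * v$2" for v
  proof -
    have "v = (v$1) *\<^sub>R axis 1 1 + (v$2) *\<^sub>R axis 2 1"
      by (simp add: vec_eq_iff forall_2 axis_def)
    then have "frechet_derivative F (at q) v = frechet_derivative F (at q) ((v$1) *\<^sub>R axis 1 1 + (v$2) *\<^sub>R axis 2 1)"
      by simp
    then show ?thesis
      using linear_frechet_derivative[OF assms] by (simp add: linear_add linear_cmul)
  qed
  then have eq: "frechet_derivative F (at q) = (\<lambda>v. partial 1 F q * v$1 + partial 2 F q * v$2)"
    by (rule ext)
  have "(F has_derivative frechet_derivative F (at q)) (at q)"
    using assms frechet_derivative_works by blast
  then show ?thesis by (rule has_derivative_eq_rhs) (rule eq)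
qed

lemma has_gradient_along:
  fixes v :: "real^2"
  assumes "has_gradient F a b q"
  shows "((\<lambda>s. F (q + s *\<^sub>R v)) has_real_derivative a * v$1 + b * v$2) (at 0)"
proof -
  have "(F has_derivative (\<lambda>v. a * v$1 + b * v$2)) (at (q + 0 *\<^sub>R v))" using assms by simp
  moreover have "((\<lambda>s. q + s *\<^sub>R v) has_derivative (\<lambda>s. s *\<^sub>R v)) (at 0)"
    by (auto intro!: derivative_eq_intros)
  ultimately have "((\<lambda>s. F (q + s *\<^sub>R v)) has_derivative (\<lambda>s. a * (s *\<^sub>R v)$1 + b * (s *\<^sub>R v)$2)) (at 0)"
    using has_derivative_compose[of "\<lambda>s. q + s *\<^sub>R v"] by blast
  then show ?thesis unfolding has_field_derivative_def
    by (rule has_derivative_eq_rhs) (auto simp: algebra_simps)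
qed

lemma has_gradient_unique:
  assumes "has_gradient F a b q" "has_gradient F a' b' q"
  shows "a = a'" "b = b'"
proof -
  have "(\<lambda>v::real^2. a * v$1 + b * v$2) = (\<lambda>v. a' * v$1 + b' * v$2)"
    using has_derivative_unique assms by blast
  from fun_cong[OF this, of "axis 1 1"] fun_cong[OF this, of "axis 2 1"]
  show "a = a'" "b = b'" by (simp_all add: axis_def)
qed

lemma partial_commute:
  assumes U: "open U" "q \<in> U" and F: "smooth_on U F"
  shows "partial 1 (partial 2 F) q = partial 2 (partial 1 F) q"
proof -
  have along: "((\<lambda>s. G (q + s *\<^sub>R axis i 1)) has_real_derivative partial i G q) (at 0)"
    if "smooth_on U G" "q \<in> U" for G i q
    using has_gradient_along[OF has_gradient_partial[OF smooth_on_differentiable[OF that]], of "axis i 1"]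
      exhaust_2[of i] by (auto simp: axis_def)
  show ?thesis
    by (rule mixed_derivatives_commute[OF U along along along along])
      (auto intro!: F smooth_on_frechet_derivative smooth_on_continuous_on)
qed

text \<open>If the quadratic form were positive at \<open>(a, b)\<close>, the derivative of
  \<open>F\<close> along that line would increase through 0 at \<open>q\<close>, and
  \<open>F\<close> would exceed its maximum nearby. Keeping \<open>F12\<close> and
  \<open>F21\<close> apart admits a test function whose Hessian entries were computed in two
  different ways.\<close>

lemma second_derivative_test:
  assumes "open U" "q \<in> U" and max: "\<And>z. z \<in> U \<Longrightarrow> F z \<le> F q"
    and F: "\<And>z. z \<in> U \<Longrightarrow> has_gradient F (F1 z) (F2 z) z"
    and F1: "has_gradient F1 F11 F12 q" and F2: "has_gradient F2 F21 F22 q"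
  shows "F1 q = 0" "F2 q = 0" "F11 * a\<^sup>2 + (F12 + F21) * a * b + F22 * b\<^sup>2 \<le> 0"
proof -
  have ev: "\<exists>d>0. \<forall>s. \<bar>s\<bar> < d \<longrightarrow> q + s *\<^sub>R v \<in> U" for v
  proof -
    obtain d where d: "d > 0" "ball q d \<subseteq> U" using assms(1,2) openE by blast
    have nz: "norm v + 1 > 0" by (simp add: add_nonneg_pos)
    have "q + s *\<^sub>R v \<in> U" if "\<bar>s\<bar> < d / (norm v + 1)" for s
    proof -
      have "dist q (q + s *\<^sub>R v) = \<bar>s\<bar> * norm v" by (simp add: dist_norm)
      also have "\<dots> \<le> \<bar>s\<bar> * (norm v + 1)" by (simp add: mult_left_mono)
      also have "\<dots> < d" using that nz by (simp add: pos_less_divide_eq)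
      finally show ?thesis using d by auto
    qed
    then show ?thesis using d nz by (metis zero_less_divide_iff)
  qed
  have crit: "F1 q * v$1 + F2 q * v$2 = 0" for v :: "real^2"
  proof -
    obtain d where d: "d > 0" "\<And>s. \<bar>s\<bar> < d \<Longrightarrow> q + s *\<^sub>R v \<in> U" using ev by metis
    show ?thesis
      by (rule DERIV_local_max[OF has_gradient_along[OF F[OF assms(2)]] d(1)])
        (use d max in auto)
  qed
  show "F1 q = 0" "F2 q = 0"
    using crit[of "axis 1 1"] crit[of "axis 2 1"] by (simp_all add: axis_def)
  define v :: "real^2" where "v = vector [a, b]"
  have v: "v$1 = a" "v$2 = b" by (simp_all add: v_def)
  show "F11 * a\<^sup>2 + (F12 + F21) * a * b + F22 * b\<^sup>2 \<le> 0"
  proof (rule ccontr)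
    assume "\<not> ?thesis"
    then have pos: "0 < (F11 * v$1 + F12 * v$2) * a + (F21 * v$1 + F22 * v$2) * b"
      by (simp add: v power2_eq_square algebra_simps)
    \<comment> \<open>\<open>g\<close> is the derivative of \<open>F\<close> along the line; its own
      derivative at 0 is the quadratic form.\<close>
    define g where "g s = F1 (q + s *\<^sub>R v) * a + F2 (q + s *\<^sub>R v) * b" for s
    have "(g has_real_derivative (F11 * v$1 + F12 * v$2) * a + (F21 * v$1 + F22 * v$2) * b) (at 0)"
      unfolding g_def by (intro DERIV_add DERIV_cmult_right has_gradient_along F1 F2)
    from DERIV_pos_inc_right[OF this pos] obtain d1 where
      d1: "d1 > 0" "\<And>s. 0 < s \<Longrightarrow> s < d1 \<Longrightarrow> g 0 < g s" by auto
    have g0: "g 0 = 0" using crit[of v] by (simp add: g_def v)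
    obtain d where d: "d > 0" "\<And>s. \<bar>s\<bar> < d \<Longrightarrow> q + s *\<^sub>R v \<in> U" using ev by metis
    define h where "h = min d d1 / 2"
    have h: "0 < h" "h < d" "h < d1" using d d1 by (auto simp: h_def)
    have "\<exists>s. 0 < s \<and> s < h \<and> F (q + h *\<^sub>R v) - F (q + 0 *\<^sub>R v) = (h - 0) * g s"
    proof (rule MVT2[OF h(1), where f = "\<lambda>s. F (q + s *\<^sub>R v)"])
      fix s assume "0 \<le> s" "s \<le> h"
      then have "q + s *\<^sub>R v \<in> U" using d(2) h by auto
      from has_gradient_along[OF F[OF this], of v]
      have "((\<lambda>r. F (q + (r + s) *\<^sub>R v)) has_real_derivative g s) (at 0)"
        by (simp add: g_def v algebra_simps)
      then show "((\<lambda>s. F (q + s *\<^sub>R v)) has_real_derivative g s) (at s)"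
        using DERIV_shift[of "\<lambda>r. F (q + r *\<^sub>R v)" "g s" 0 s] by simp
    qed
    then obtain s where "0 < s" "s < h" "F (q + h *\<^sub>R v) - F q = h * g s" by auto
    moreover have "h * g s > 0" using d1(2)[of s] h g0 calculation by auto
    ultimately show False using max[OF d(2), of h] h by auto
  qed
qed

section \<open>Algebra of the maximum principle at a single point\<close>

text \<open>The adjugate of the negative definite matrix \<open>b\<close> is negative definite, and
  so has nonnegative trace against a negative semidefinite form. Concretely, \<open>b11\<close>
  times this trace is the determinant times \<open>F11\<close> plus the value of the form at
  \<open>(b12, - b11)\<close>.\<close>

lemma trace_adjugate_nonneg:
  fixes b11 b12 b22 F11 F22 G :: real
  assumes "b11 < 0" "b11 * b22 - b12\<^sup>2 > 0"
    and F: "\<And>x y. F11 * x\<^sup>2 + G * x * y + F22 * y\<^sup>2 \<le> 0"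
  shows "0 \<le> b22 * F11 - b12 * G + b11 * F22"
proof -
  have "F11 \<le> 0" using F[of 1 0] by simp
  then have "(b11 * b22 - b12\<^sup>2) * F11 \<le> 0" using assms(2) by (simp add: mult_nonneg_nonpos)
  moreover have "F11 * b12\<^sup>2 + G * b12 * (- b11) + F22 * (- b11)\<^sup>2 \<le> 0" by (rule F)
  moreover have "b11 * (b22 * F11 - b12 * G + b11 * F22)
      = (b11 * b22 - b12\<^sup>2) * F11 + (F11 * b12\<^sup>2 + G * b12 * (- b11) + F22 * (- b11)\<^sup>2)"
    by (simp add: algebra_simps power2_eq_square)
  ultimately have "b11 * (b22 * F11 - b12 * G + b11 * F22) \<le> 0" by linarith
  then show ?thesis using assms(1) by (simp add: mult_le_0_iff)
qed

text \<open>This settles a horizontal tangent plane, where \<open>T\<close> is the trace of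
  \<open>b\<close> and \<open>c^2\<close> its determinant. The expression is \<open>c\<close> times
  the difference of \<open>(T + 2 * c) * (c - lam * s)\<close>, which is nonpositive since
  \<open>T \<le> - 2 * c\<close> and \<open>lam * s \<le> c\<close>, and the positive number
  \<open>2 * c * ((1 - lam) * (s + c))\<close>.\<close>

lemma at_critical_slice_point:
  fixes c s lam T :: real
  assumes "c > 0" "0 < lam" "lam < 1" "0 \<le> s" "s \<le> c" and T: "T < 0" "T\<^sup>2 \<ge> 4 * c\<^sup>2"
  shows "lam * c * (2 * c\<^sup>2 - s * T) + c\<^sup>2 * (T - 2 * s) < 0"
proof -
  have "T\<^sup>2 \<ge> (2 * c)\<^sup>2" using T(2) by (simp add: power_mult_distrib)
  then have "\<bar>T\<bar> \<ge> 2 * c" using assms(1) by (metis abs_le_square_iff abs_of_pos mult_pos_pos zero_less_numeral)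
  then have t: "T + 2 * c \<le> 0" using T(1) by linarith
  have "lam * s \<le> 1 * c" using assms by (intro mult_mono) auto
  then have "(T + 2 * c) * (c - lam * s) \<le> 0" using t by (simp add: mult_nonpos_nonneg)
  moreover have "0 < (1 - lam) * (s + c)" using assms by (intro mult_pos_pos) auto
  ultimately have "(T + 2 * c) * (c - lam * s) - 2 * c * ((1 - lam) * (s + c)) < 0"
    using assms(1) by (smt (verit) mult_pos_pos)
  then have "c * ((T + 2 * c) * (c - lam * s) - 2 * c * ((1 - lam) * (s + c))) < 0"
    using assms(1) by (simp add: mult_pos_neg)
  then show ?thesis by (simp add: algebra_simps power2_eq_square)
qed

text \<open>This settles a tangent plane that is not horizontal; \<open>T\<close> and
  \<open>d\<close> are the trace and determinant of \<open>b\<close>, and \<open>n\<close> is the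
  squared length of \<open>P\<close>. The relation \<open>d = - k * (T + k)\<close> makes
  \<open>- k\<close> an eigenvalue of \<open>b\<close> and so determines the other one. In terms of
  \<open>m = E / R\<close>, the reciprocal of the absolute value of \<nu>, everything collapses to
  one product whose sign is decided by \<open>lam < 1\<close>.\<close>

lemma at_critical_point:
  fixes c s lam E R Q n k T d X :: real
  assumes pos: "c > 0" "0 < lam" "lam < 1" "0 \<le> s" "E > 0" "R > 0"
    and Q: "R\<^sup>2 * Q = 1" "Q * E\<^sup>2 = 1 + E\<^sup>2 * n"
    and d: "d = c\<^sup>2 * Q\<^sup>2 * E ^ 4" "d = - k * (T + k)"
    and k: "k * R ^ 3 = lam * c * E ^ 3" and X: "X = - k * n"
  shows "lam * c * (- 3 * s * E ^ 5 * (T * n - X) + E ^ 3 * (2 * d - s * T))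
     + R ^ 3 * (d * (4 * X / Q - 4 * s * E\<^sup>2 * n) + d * (T - 2 * s)) - 3 * R ^ 5 * d * X < 0"
proof -
  define m where "m = E / R"
  have m: "m > 0" using pos by (simp add: m_def)
  have E: "E = m * R" using pos by (simp add: m_def)
  have Q': "Q = 1 / R\<^sup>2" using Q(1) pos by (simp add: field_simps)
  have n: "n = (m\<^sup>2 - 1) / (m\<^sup>2 * R\<^sup>2)"
    using Q(2) pos m unfolding E Q' by (simp add: field_simps)
  have kk: "k = lam * c * m ^ 3"
    using k pos unfolding E by (simp add: power_mult_distrib)
  have dd: "d = c\<^sup>2 * m ^ 4" using d(1) pos unfolding E Q' by (simp add: field_simps)
  have kpos: "k > 0" using pos m by (simp add: kk)
  have "T = - d / k - k" using d(2) kpos by (simp add: field_simps)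
  then have T: "T = - (c * m / lam + lam * c * m ^ 3)"
    using pos m unfolding dd kk by (simp add: field_simps power2_eq_square eval_nat_numeral)
  have X': "X = - lam * c * m * (m\<^sup>2 - 1) / R\<^sup>2"
    using pos m unfolding X kk n by (simp add: field_simps power2_eq_square eval_nat_numeral)
  have "lam * c * (- 3 * s * E ^ 5 * (T * n - X) + E ^ 3 * (2 * d - s * T))
     + R ^ 3 * (d * (4 * X / Q - 4 * s * E\<^sup>2 * n) + d * (T - 2 * s)) - 3 * R ^ 5 * d * X
     = - (R ^ 3 * c\<^sup>2 * m ^ 6 * (s * (1 - lam\<^sup>2) + c * (1 / lam - lam) / m))"
    using pos m unfolding E X' T dd Q' n
    by (simp add: field_simps) algebra
  moreover have "1 - lam\<^sup>2 > 0" using pos by (simp add: power_less_one_iff abs_square_less_1)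
  moreover have "1 / lam - lam > 0" using pos calculation(2) by (simp add: field_simps power2_eq_square)
  ultimately show ?thesis using pos m
    by (smt (verit) divide_pos_pos mult_nonneg_nonneg mult_pos_pos zero_less_power)
qed

text \<open>The case distinction of the maximum principle, with names as in the locale \<open>warped_graph\<close> below:
  \<open>d1\<close> and \<open>d2\<close> are the differentiated curvature equation, and the trace of the Hessian \<open>F\<close> against the adjugate
  of \<open>b\<close> is both nonnegative and negative.\<close>

lemma no_second_order_maximum:
  fixes c s t lam E R Q P1 P2 b11 b12 b22 p111 p112 p122 p222 W1 W2 :: real
  assumes pos: "c > 0" "0 < lam" "lam < 1" "0 \<le> s" "s \<le> c" "0 \<le> t" "E > 0" "R > 0"
    and Q: "R\<^sup>2 * Q = 1" "Q * E\<^sup>2 = 1 + E\<^sup>2 * (P1\<^sup>2 + P2\<^sup>2)"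
    and det: "b11 * b22 - b12\<^sup>2 = c\<^sup>2 * Q\<^sup>2 * E ^ 4" and neg: "b11 < 0"
    and W: "W1 = b11 * P1 + b12 * P2" "W2 = b12 * P1 + b22 * P2"
    and d1: "(p111 - t * P1) * b22 + b11 * (p122 - t * P1) - 2 * b12 * p112
              = c\<^sup>2 * (4 * Q * W1 * E ^ 4 - 4 * s * E ^ 6 * P1 * Q\<^sup>2)"
    and d2: "(p112 - t * P2) * b22 + b11 * (p222 - t * P2) - 2 * b12 * p122
              = c\<^sup>2 * (4 * Q * W2 * E ^ 4 - 4 * s * E ^ 6 * P2 * Q\<^sup>2)"
    and crit: "lam * c * E ^ 3 * P1 + R ^ 3 * W1 = 0" "lam * c * E ^ 3 * P2 + R ^ 3 * W2 = 0"
    and F11: "F11 = lam * c * (- 3 * s * E ^ 5 * P1 * P1 + E ^ 3 * (b11 - s))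
      + R ^ 3 * ((p111 - t * P1) * P1 + b11 * (b11 - s) + p112 * P2 + b12 * b12) - 3 * R ^ 5 * W1 * W1"
    and F12: "F12 = lam * c * (- 3 * s * E ^ 5 * P1 * P2 + E ^ 3 * b12)
      + R ^ 3 * ((p112 - t * P2) * P1 + b11 * b12 + p122 * P2 + b12 * (b22 - s)) - 3 * R ^ 5 * W1 * W2"
    and F21: "F21 = lam * c * (- 3 * s * E ^ 5 * P1 * P2 + E ^ 3 * b12)
      + R ^ 3 * (p112 * P1 + b12 * (b11 - s) + (p122 - t * P1) * P2 + b22 * b12) - 3 * R ^ 5 * W1 * W2"
    and F22: "F22 = lam * c * (- 3 * s * E ^ 5 * P2 * P2 + E ^ 3 * (b22 - s))
      + R ^ 3 * (p122 * P1 + b12 * b12 + (p222 - t * P2) * P2 + b22 * (b22 - s)) - 3 * R ^ 5 * W2 * W2"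
    and test: "\<And>x y. F11 * x\<^sup>2 + (F12 + F21) * x * y + F22 * y\<^sup>2 \<le> 0"
  shows False
proof -
  define T where "T = b11 + b22"
  define d where "d = b11 * b22 - b12\<^sup>2"
  define n where "n = P1\<^sup>2 + P2\<^sup>2"
  define X where "X = P1 * W1 + P2 * W2"
  have Qpos: "Q > 0" using Q(1) pos by (metis zero_less_mult_pos zero_less_one zero_less_power)
  have dpos: "d > 0" using det Qpos pos by (simp add: d_def)
  have M0: "0 \<le> b22 * F11 - b12 * (F12 + F21) + b11 * F22"
    by (rule trace_adjugate_nonneg[OF neg _ test]) (use dpos in \<open>simp add: d_def\<close>)
  define A where "A = (p111 - t * P1) * b22 + b11 * (p122 - t * P1) - 2 * b12 * p112"
  define B where "B = (p112 - t * P2) * b22 + b11 * (p222 - t * P2) - 2 * b12 * p122"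
  have "P1 * A + P2 * B = c\<^sup>2 * (4 * Q * X * E ^ 4 - 4 * s * E ^ 6 * n * Q\<^sup>2)"
    unfolding A_def B_def d1 d2 X_def n_def by (simp add: algebra_simps power2_eq_square)
  also have "\<dots> = d * (4 * X / Q - 4 * s * E\<^sup>2 * n)"
    using Qpos unfolding d_def det by (simp add: field_simps eval_nat_numeral)
  finally have AB: "P1 * A + P2 * B = d * (4 * X / Q - 4 * s * E\<^sup>2 * n)" .
  \<comment> \<open>Since the \<open>pijk\<close> are symmetric, third derivatives enter the trace
    only through \<open>A\<close> and \<open>B\<close>, and there only in the contraction with
    \<open>P\<close>. The differentiated curvature equation therefore eliminates them.\<close>
  have "b22 * F11 - b12 * (F12 + F21) + b11 * F22 =
      lam * c * (- 3 * s * E ^ 5 * (T * n - X) + E ^ 3 * (2 * d - s * T))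
     + R ^ 3 * ((P1 * A + P2 * B) + t * X + d * (T - 2 * s)) - 3 * R ^ 5 * d * X"
    unfolding F11 F12 F21 F22 A_def B_def T_def d_def n_def X_def W by algebra
  then have M: "0 \<le> lam * c * (- 3 * s * E ^ 5 * (T * n - X) + E ^ 3 * (2 * d - s * T))
     + R ^ 3 * (d * (4 * X / Q - 4 * s * E\<^sup>2 * n) + t * X + d * (T - 2 * s)) - 3 * R ^ 5 * d * X"
    using M0 unfolding AB by simp
  have b22: "b22 < 0"
    using dpos neg unfolding d_def by (smt (verit) mult_nonpos_nonneg zero_le_power2)
  have T: "T < 0" "T\<^sup>2 \<ge> 4 * d"
  proof -
    show "T < 0" using neg b22 by (simp add: T_def)
    have "T\<^sup>2 - 4 * d = (b11 - b22)\<^sup>2 + 4 * b12\<^sup>2"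
      by (simp add: T_def d_def power2_eq_square algebra_simps)
    also have "\<dots> \<ge> 0" by simp
    finally show "T\<^sup>2 \<ge> 4 * d" by simp
  qed
  show False
  proof (cases "P1 = 0 \<and> P2 = 0")
    case True
    then have z: "n = 0" "X = 0" by (simp_all add: n_def X_def)
    have "Q * E\<^sup>2 = 1" using Q(2) True by simp
    then have "E\<^sup>2 = R\<^sup>2" using Q(1) Qpos by (metis mult.commute mult_left_cancel less_irrefl)
    then have "E = R" using pos by (simp add: power2_eq_iff_nonneg)
    have "d = c\<^sup>2 * (Q * E\<^sup>2)\<^sup>2" unfolding d_def det by (simp add: power_mult_distrib power_mult[symmetric])
    then have "d = c\<^sup>2" using \<open>Q * E\<^sup>2 = 1\<close> by simp
    have "0 \<le> R ^ 3 * (lam * c * (2 * c\<^sup>2 - s * T) + c\<^sup>2 * (T - 2 * s))"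
      using M unfolding z \<open>d = c\<^sup>2\<close> \<open>E = R\<close> by (simp add: algebra_simps)
    then show False
      using at_critical_slice_point[OF pos(1-5) T(1)] T(2) \<open>d = c\<^sup>2\<close> \<open>R > 0\<close>
      by (smt (verit) mult_pos_neg zero_less_power)
  next
    case False
    \<comment> \<open>With this \<open>k\<close> the critical point equations say that
      \<open>P\<close> is an eigenvector of \<open>b\<close> for the eigenvalue \<open>- k\<close>.
      As \<open>P\<close> is nonzero, the determinant of \<open>b + k I\<close> vanishes.\<close>
    define k where "k = lam * c * E ^ 3 / R ^ 3"
    have kpos: "k > 0" using pos by (simp add: k_def)
    have kR: "k * R ^ 3 = lam * c * E ^ 3" using pos by (simp add: k_def)
    have "R ^ 3 * (W1 + k * P1) = 0" "R ^ 3 * (W2 + k * P2) = 0"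
      using crit kR by (simp_all add: algebra_simps)
    then have ev: "W1 = - k * P1" "W2 = - k * P2" using pos by simp_all
    have X: "X = - k * n" by (simp add: X_def n_def ev algebra_simps power2_eq_square)
    have ev1: "(b11 + k) * P1 + b12 * P2 = 0" "b12 * P1 + (b22 + k) * P2 = 0"
      using ev W by (simp_all add: algebra_simps)
    have "((b11 + k) * (b22 + k) - b12\<^sup>2) * P1 = 0" "((b11 + k) * (b22 + k) - b12\<^sup>2) * P2 = 0"
      using ev1 by algebra+
    then have "(b11 + k) * (b22 + k) - b12\<^sup>2 = 0" using False by auto
    then have dk: "d = - k * (T + k)" by (simp add: d_def T_def algebra_simps)
    have n: "n \<ge> 0" by (simp add: n_def)
    \<comment> \<open>The contribution of the second derivative of \<open>f\<close> has the same
      sign as the rest, so it can be split off.\<close>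
    have "R ^ 3 * (t * X) \<le> 0" unfolding X using kpos n pos by simp
    moreover have "lam * c * (- 3 * s * E ^ 5 * (T * n - X) + E ^ 3 * (2 * d - s * T))
     + R ^ 3 * (d * (4 * X / Q - 4 * s * E\<^sup>2 * n) + d * (T - 2 * s)) - 3 * R ^ 5 * d * X < 0"
      by (rule at_critical_point[OF pos(1-4) pos(7,8) Q(1) Q(2)[folded n_def] _ dk kR X])
        (simp add: d_def det)
    ultimately show False using M by (simp add: algebra_simps)
  qed
qed

section \<open>Rules for computing gradients\<close>

lemma has_gradient_transform:
  assumes "open U" "q \<in> U" "\<And>z. z \<in> U \<Longrightarrow> F z = G z" "has_gradient G a b q"
  shows "has_gradient F a b q"
  using has_derivative_transform_within_open[OF assms(4,1,2)] assms(3) by simp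

text \<open>Separates differentiation by rules, which leaves coefficients of a fixed shape, from the
  algebraic comparison with the wanted coefficients.\<close>

lemma has_gradient_cong:
  "has_gradient F a b q \<Longrightarrow> a = a' \<Longrightarrow> b = b' \<Longrightarrow> has_gradient F a' b' q"
  by simp

lemma has_gradient_compose:
  assumes "has_gradient F a b q" "DERIV g (F q) :> d"
  shows "has_gradient (\<lambda>z. g (F z)) (d * a) (d * b) q"
proof -
  have "((\<lambda>z. g (F z)) has_derivative (\<lambda>v. d * (a * v$1 + b * v$2))) (at q)"
    using has_derivative_compose[OF assms(1)] assms(2) unfolding has_field_derivative_def by blast
  then show ?thesis by (rule has_derivative_eq_rhs) (auto simp: algebra_simps)
qed

lemma has_gradient_add:
  assumes "has_gradient F a b q" "has_gradient G a' b' q"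
  shows "has_gradient (\<lambda>z. F z + G z) (a + a') (b + b') q"
  by (rule has_derivative_eq_rhs[OF has_derivative_add[OF assms]]) (auto simp: algebra_simps)

lemma has_gradient_diff:
  assumes "has_gradient F a b q" "has_gradient G a' b' q"
  shows "has_gradient (\<lambda>z. F z - G z) (a - a') (b - b') q"
  by (rule has_derivative_eq_rhs[OF has_derivative_diff[OF assms]]) (auto simp: algebra_simps)

lemma has_gradient_mult:
  assumes "has_gradient F a b q" "has_gradient G a' b' q"
  shows "has_gradient (\<lambda>z. F z * G z) (F q * a' + a * G q) (F q * b' + b * G q) q"
  by (rule has_derivative_eq_rhs[OF has_derivative_mult[OF assms]]) (auto simp: algebra_simps)

lemma has_gradient_const: "has_gradient (\<lambda>z. k) 0 0 q"
  by simp

lemma has_gradient_power: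
  assumes "has_gradient F a b q"
  shows "has_gradient (\<lambda>z. F z ^ n) (n * F q ^ (n - 1) * a) (n * F q ^ (n - 1) * b) q"
  by (rule has_gradient_compose[OF assms, of "\<lambda>x. x ^ n"]) (auto intro!: derivative_eq_intros)

lemmas has_gradient_intros = has_gradient_add has_gradient_diff has_gradient_mult
  has_gradient_const has_gradient_power

section \<open>Local geometry of a graph and its derivatives up to third order\<close>

locale warped_graph =
  fixes f :: "real \<Rightarrow> real" and U :: "(real^2) set" and u :: "real^2 \<Rightarrow> real"
  assumes f_smooth: "smooth_on UNIV f" and U_open: "open U" and u_smooth: "smooth_on U u"
begin

text \<open>Only one order of differentiation is named for each multi-index; the other orders are
  reduced to it by commuting partial derivatives.\<close>

abbreviation "u1 \<equiv> partial 1 u"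
abbreviation "u2 \<equiv> partial 2 u"
abbreviation "u11 \<equiv> partial 1 u1"
abbreviation "u12 \<equiv> partial 2 u1"
abbreviation "u22 \<equiv> partial 2 u2"
abbreviation "u111 \<equiv> partial 1 u11"
abbreviation "u112 \<equiv> partial 2 u11"
abbreviation "u122 \<equiv> partial 2 u12"
abbreviation "u222 \<equiv> partial 2 u22"

lemma grad_smooth: "smooth_on U F \<Longrightarrow> q \<in> U \<Longrightarrow> has_gradient F (partial 1 F q) (partial 2 F q) q"
  by (rule has_gradient_partial[OF smooth_on_differentiable])

lemma grad_u: "q \<in> U \<Longrightarrow> has_gradient u (u1 q) (u2 q) q"
  by (rule grad_smooth[OF u_smooth])

lemma grad_u1: "q \<in> U \<Longrightarrow> has_gradient u1 (u11 q) (u12 q) q"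
  by (rule grad_smooth[OF smooth_on_frechet_derivative[OF u_smooth]])

lemma grad_u2:
  assumes q: "q \<in> U"
  shows "has_gradient u2 (u12 q) (u22 q) q"
  by (rule has_gradient_cong[OF grad_smooth[OF smooth_on_frechet_derivative[OF u_smooth] q]
        partial_commute[OF U_open q u_smooth] refl])

lemma grad_u11: "q \<in> U \<Longrightarrow> has_gradient u11 (u111 q) (u112 q) q"
  by (rule grad_smooth[OF smooth_on_frechet_derivative[OF smooth_on_frechet_derivative[OF u_smooth]]])

lemma grad_u12:
  assumes q: "q \<in> U"
  shows "has_gradient u12 (u112 q) (u122 q) q"
  by (rule has_gradient_cong[OF grad_smooth[OF smooth_on_frechet_derivative[OF smooth_on_frechet_derivative[OF u_smooth]] q]
        partial_commute[OF U_open q smooth_on_frechet_derivative[OF u_smooth]] refl])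

lemma grad_u22:
  assumes q: "q \<in> U"
  shows "has_gradient u22 (u122 q) (u222 q) q"
proof -
  have u2: "smooth_on U u2" by (rule smooth_on_frechet_derivative[OF u_smooth])
  \<comment> \<open>Since \<open>partial 1 u2\<close> agrees with \<open>u12\<close> on the open set
    \<open>U\<close>, the two have the same gradient there.\<close>
  have "has_gradient (partial 1 u2) (u112 q) (u122 q) q"
    by (rule has_gradient_transform[OF U_open q _ grad_u12[OF q]])
      (rule partial_commute[OF U_open _ u_smooth])
  moreover have "has_gradient (partial 1 u2) (partial 1 (partial 1 u2) q) (partial 2 (partial 1 u2) q) q"
    by (rule grad_smooth[OF smooth_on_frechet_derivative[OF u2] q])
  ultimately have "partial 2 (partial 1 u2) q = u122 q" by (rule has_gradient_unique(2)[symmetric])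
  with partial_commute[OF U_open q u2] have "partial 1 u22 q = u122 q" by (rule trans)
  from has_gradient_cong[OF grad_smooth[OF smooth_on_frechet_derivative[OF u2] q] this refl]
  show ?thesis .
qed

text \<open>\<open>P = (P1, P2)\<close> is the gradient of \<open>w = g \<circ> u\<close>, where \<open>g' = exp (- 2 * f)\<close>; in terms of \<open>w\<close> the
  second fundamental form is, up to a factor, the matrix \<open>b = Hess w + s I\<close>, and \<open>R = e\<^sup>f \<bar>\<nu>\<bar>\<close>. The functions
  \<open>pijk\<close> are the third derivatives of \<open>w\<close>, which are symmetric in the three indices.\<close>

definition "E q = exp (f (u q))"
definition "r q = exp (- 2 * f (u q))"
definition "s q = - deriv f (u q)"
definition "t q = deriv (deriv f) (u q) * (E q)\<^sup>2"
definition "P1 q = r q * u1 q"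
definition "P2 q = r q * u2 q"
definition "b11 q = r q * u11 q + 2 * s q * (E q)\<^sup>2 * P1 q * P1 q + s q"
definition "b12 q = r q * u12 q + 2 * s q * (E q)\<^sup>2 * P1 q * P2 q"
definition "b22 q = r q * u22 q + 2 * s q * (E q)\<^sup>2 * P2 q * P2 q + s q"
definition "p111 q = r q * u111 q + 6 * s q * (E q)\<^sup>2 * P1 q * (b11 q - s q)
  - (8 * (s q)\<^sup>2 * E q ^ 4 + 2 * t q * (E q)\<^sup>2) * P1 q * P1 q * P1 q"
definition "p112 q = r q * u112 q + 2 * s q * (E q)\<^sup>2 * (2 * P1 q * b12 q + P2 q * (b11 q - s q))
  - (8 * (s q)\<^sup>2 * E q ^ 4 + 2 * t q * (E q)\<^sup>2) * P1 q * P1 q * P2 q"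
definition "p122 q = r q * u122 q + 2 * s q * (E q)\<^sup>2 * (2 * P2 q * b12 q + P1 q * (b22 q - s q))
  - (8 * (s q)\<^sup>2 * E q ^ 4 + 2 * t q * (E q)\<^sup>2) * P1 q * P2 q * P2 q"
definition "p222 q = r q * u222 q + 6 * s q * (E q)\<^sup>2 * P2 q * (b22 q - s q)
  - (8 * (s q)\<^sup>2 * E q ^ 4 + 2 * t q * (E q)\<^sup>2) * P2 q * P2 q * P2 q"
text \<open>If \<open>a\<close> is the first component of a unit normal, then
  \<open>a^2 * Q = r\<close>, so \<open>Q\<close> is the normalising factor. The vector
  \<open>W = b P\<close> is half the gradient of \<open>Q\<close>.\<close>

definition "Q q = r q + (P1 q)\<^sup>2 + (P2 q)\<^sup>2"
definition "W1 q = b11 q * P1 q + b12 q * P2 q"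
definition "W2 q = b12 q * P1 q + b22 q * P2 q"
definition "R q = inverse (sqrt (Q q))"

lemma E_pos: "E q > 0" and r_pos: "r q > 0" and E_r: "(E q)\<^sup>2 * r q = 1"
  by (simp_all add: E_def r_def power2_eq_square exp_add[symmetric])

lemma u1_eq: "u1 q = (E q)\<^sup>2 * P1 q" and u2_eq: "u2 q = (E q)\<^sup>2 * P2 q"
  using E_r[of q] by (simp_all add: P1_def P2_def mult.assoc[symmetric])

lemma Q_pos: "Q q > 0"
  unfolding Q_def using r_pos[of q] by (simp add: add_pos_nonneg)

lemma R_pos: "R q > 0" and R_Q: "(R q)\<^sup>2 * Q q = 1"
  using Q_pos[of q] by (simp_all add: R_def power_inverse)

lemma Q_E: "Q q * (E q)\<^sup>2 = 1 + (E q)\<^sup>2 * ((P1 q)\<^sup>2 + (P2 q)\<^sup>2)"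
  using E_r[of q] by (simp add: Q_def algebra_simps)

lemma DERIV_f: "DERIV f x :> deriv f x"
  by (rule smooth_on_DERIV[OF f_smooth])

lemma DERIV_deriv_f: "DERIV (deriv f) x :> deriv (deriv f) x"
  by (rule smooth_on_DERIV(1)[OF smooth_on_DERIV(2)[OF f_smooth]])

text \<open>This and the following gradients are expressed again in the locale's quantities, which
  makes the system closed under differentiation and the later identities purely algebraic.\<close>

lemma grad_E: "q \<in> U \<Longrightarrow> has_gradient E (- s q * E q ^ 3 * P1 q) (- s q * E q ^ 3 * P2 q) q"
  unfolding E_def[abs_def]
  by (rule has_gradient_cong[OF has_gradient_compose[OF grad_u DERIV_fun_exp[OF DERIV_f]]])
    (auto simp: s_def u1_eq u2_eq E_def power2_eq_square power3_eq_cube)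

lemma grad_r: "q \<in> U \<Longrightarrow> has_gradient r (2 * s q * P1 q) (2 * s q * P2 q) q"
  unfolding r_def[abs_def]
  by (rule has_gradient_cong[OF has_gradient_compose[OF grad_u DERIV_fun_exp[OF DERIV_cmult[OF DERIV_f]]]])
    (auto simp: s_def P1_def P2_def r_def)

lemma grad_s: "q \<in> U \<Longrightarrow> has_gradient s (- t q * P1 q) (- t q * P2 q) q"
  unfolding s_def[abs_def]
  by (rule has_gradient_cong[OF has_gradient_compose[OF grad_u DERIV_minus[OF DERIV_deriv_f]]])
    (auto simp: t_def u1_eq u2_eq)

lemma grad_P1: "q \<in> U \<Longrightarrow> has_gradient P1 (b11 q - s q) (b12 q) q"
  unfolding P1_def[abs_def]
  by (rule has_gradient_cong[OF has_gradient_mult[OF grad_r grad_u1]])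
    (auto simp: b11_def b12_def u1_eq algebra_simps)

lemma grad_P2: "q \<in> U \<Longrightarrow> has_gradient P2 (b12 q) (b22 q - s q) q"
  unfolding P2_def[abs_def]
  by (rule has_gradient_cong[OF has_gradient_mult[OF grad_r grad_u2]])
    (auto simp: b22_def b12_def u2_eq algebra_simps)

lemma hessian_eqs:
  "u11 q = (E q)\<^sup>2 * (b11 q - s q - 2 * s q * (E q)\<^sup>2 * P1 q * P1 q)"
  "u12 q = (E q)\<^sup>2 * (b12 q - 2 * s q * (E q)\<^sup>2 * P1 q * P2 q)"
  "u22 q = (E q)\<^sup>2 * (b22 q - s q - 2 * s q * (E q)\<^sup>2 * P2 q * P2 q)"
  using E_r[of q] by (simp_all add: b11_def b12_def b22_def mult.assoc[symmetric])

text \<open>This lemma and the next two are the Codazzi equation in coordinates. As \<open>b\<close>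
  differs from the Hessian of \<open>w\<close> by \<open>s I\<close>, its derivatives are the
  symmetric \<open>pijk\<close>, corrected on the diagonal by the gradient \<open>- t P\<close> of
  \<open>s\<close>.\<close>

lemma grad_b11: "q \<in> U \<Longrightarrow> has_gradient b11 (p111 q - t q * P1 q) (p112 q - t q * P2 q) q"
  unfolding b11_def[abs_def]
  apply (rule has_gradient_cong)
    apply (rule grad_r grad_u11 grad_s grad_E grad_P1 has_gradient_intros | assumption)+
   apply (simp_all add: p111_def p112_def hessian_eqs eval_nat_numeral algebra_simps)
  done

lemma grad_b12: "q \<in> U \<Longrightarrow> has_gradient b12 (p112 q) (p122 q) q"
  unfolding b12_def[abs_def]
  apply (rule has_gradient_cong)
    apply (rule grad_r grad_u12 grad_s grad_E grad_P1 grad_P2 has_gradient_intros | assumption)+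
   apply (simp_all add: p122_def p112_def hessian_eqs eval_nat_numeral algebra_simps)
  done

lemma grad_b22: "q \<in> U \<Longrightarrow> has_gradient b22 (p122 q - t q * P1 q) (p222 q - t q * P2 q) q"
  unfolding b22_def[abs_def]
  apply (rule has_gradient_cong)
    apply (rule grad_r grad_u22 grad_s grad_E grad_P2 has_gradient_intros | assumption)+
   apply (simp_all add: p122_def p222_def hessian_eqs eval_nat_numeral algebra_simps)
  done

lemma grad_Q: "q \<in> U \<Longrightarrow> has_gradient Q (2 * W1 q) (2 * W2 q) q"
  unfolding Q_def[abs_def]
  apply (rule has_gradient_cong)
    apply (rule grad_r grad_P1 grad_P2 has_gradient_intros | assumption)+
   apply (simp_all add: W1_def W2_def algebra_simps)
  done

lemma grad_R:
  assumes "q \<in> U"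
  shows "has_gradient R (- (R q ^ 3 * W1 q)) (- (R q ^ 3 * W2 q)) q"
proof -
  have "DERIV (\<lambda>x. inverse (sqrt x)) (Q q) :> - (R q ^ 3 / 2)"
    using DERIV_inverse_fun[OF DERIV_real_sqrt[OF Q_pos[of q]]] Q_pos[of q]
    by (simp add: R_def eval_nat_numeral flip: inverse_mult_distrib)
  from has_gradient_compose[OF grad_Q[OF assms] this] show ?thesis
    unfolding R_def[abs_def] by simp
qed

text \<open>For \<open>k = lam * c\<close> the differentiated function is the first partial
  derivative of the test function, so the coefficients form the first row of its Hessian;
  \<open>grad_second\<close> supplies the second row.\<close>

lemma grad_first:
  assumes "q \<in> U"
  shows "has_gradient (\<lambda>q. k * E q ^ 3 * P1 q + R q ^ 3 * W1 q)
    (k * (- 3 * s q * E q ^ 5 * P1 q * P1 q + E q ^ 3 * (b11 q - s q))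
      + R q ^ 3 * ((p111 q - t q * P1 q) * P1 q + b11 q * (b11 q - s q) + p112 q * P2 q + b12 q * b12 q)
      - 3 * R q ^ 5 * W1 q * W1 q)
    (k * (- 3 * s q * E q ^ 5 * P1 q * P2 q + E q ^ 3 * b12 q)
      + R q ^ 3 * ((p112 q - t q * P2 q) * P1 q + b11 q * b12 q + p122 q * P2 q + b12 q * (b22 q - s q))
      - 3 * R q ^ 5 * W1 q * W2 q) q"
  unfolding W1_def[abs_def]
  apply (rule has_gradient_cong)
    apply (rule grad_E grad_P1 grad_P2 grad_R grad_b11 grad_b12 has_gradient_intros assms)+
   apply (simp_all add: W1_def W2_def eval_nat_numeral algebra_simps)
  done

lemma grad_second:
  assumes "q \<in> U"
  shows "has_gradient (\<lambda>q. k * E q ^ 3 * P2 q + R q ^ 3 * W2 q)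
    (k * (- 3 * s q * E q ^ 5 * P1 q * P2 q + E q ^ 3 * b12 q)
      + R q ^ 3 * (p112 q * P1 q + b12 q * (b11 q - s q) + (p122 q - t q * P1 q) * P2 q + b22 q * b12 q)
      - 3 * R q ^ 5 * W1 q * W2 q)
    (k * (- 3 * s q * E q ^ 5 * P2 q * P2 q + E q ^ 3 * (b22 q - s q))
      + R q ^ 3 * (p122 q * P1 q + b12 q * b12 q + (p222 q - t q * P2 q) * P2 q + b22 q * (b22 q - s q))
      - 3 * R q ^ 5 * W2 q * W2 q) q"
  unfolding W2_def[abs_def]
  apply (rule has_gradient_cong)
    apply (rule grad_E grad_P1 grad_P2 grad_R grad_b22 grad_b12 has_gradient_intros assms)+
   apply (simp_all add: W1_def W2_def eval_nat_numeral algebra_simps)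
  done

section \<open>Unit normal, shape operator and extrinsic curvature\<close>

lemma exp_2f: "exp (2 * f (u q)) = (E q)\<^sup>2"
  by (simp add: E_def power2_eq_square exp_add[symmetric])

lemma graph_map_derivative:
  assumes "q \<in> U"
  shows "frechet_derivative (graph_map u) (at q)
    = (\<lambda>v. ((E q)\<^sup>2 * (P1 q * v$1 + P2 q * v$2), v))"
proof -
  have "(graph_map u has_derivative (\<lambda>v. (u1 q * v$1 + u2 q * v$2, v))) (at q)"
    unfolding graph_map_def[abs_def]
    by (rule has_derivative_Pair[OF grad_u[OF assms] has_derivative_ident])
  from frechet_derivative_at[OF this, symmetric]
  show ?thesis by (simp add: u1_eq u2_eq algebra_simps)
qed

text \<open>Orthogonality to the tangent vectors forces \<open>N = a (1, - P)\<close>, and unit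
  length fixes \<open>a^2\<close>. Expressing everything by \<open>a = fst (N q)\<close> leaves the
  choice of sign open.\<close>

lemma normal_components:
  assumes N: "unit_normal_field (warped_metric f) (graph_map u) U N" and q: "q \<in> U"
  shows "snd (N q) $ 1 = - fst (N q) * P1 q" "snd (N q) $ 2 = - fst (N q) * P2 q"
    "(fst (N q))\<^sup>2 * Q q = r q"
proof -
  obtain a n where Nq: "N q = (a, n)" by fastforce
  have ort: "warped_metric f (graph_map u q) (frechet_derivative (graph_map u) (at q) v) (N q) = 0" for v
    using N q by (auto simp: unit_normal_field_def)
  have ort: "(E q)\<^sup>2 * ((P1 q * v$1 + P2 q * v$2) * a + (v$1 * n$1 + v$2 * n$2)) = 0" for v :: "real^2"
    using ort[of v] q
    by (simp add: graph_map_derivative Nq warped_metric_def graph_map_def exp_2f inner_vec_def sum_2 algebra_simps)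
  have ort: "(P1 q * v$1 + P2 q * v$2) * a + (v$1 * n$1 + v$2 * n$2) = 0" for v :: "real^2"
    using ort[of v] E_pos[of q] by simp
  have n: "n$1 = - a * P1 q" "n$2 = - a * P2 q"
    using ort[of "axis 1 1"] ort[of "axis 2 1"] by (simp_all add: axis_def algebra_simps)
  have "a * a + (E q)\<^sup>2 * (n$1 * n$1 + n$2 * n$2) = 1"
    using N q unfolding unit_normal_field_def
    by (auto simp: Nq warped_metric_def graph_map_def exp_2f inner_vec_def sum_2)
  then have "a\<^sup>2 * (Q q * (E q)\<^sup>2) = 1"
    unfolding n Q_E by (simp add: power2_eq_square algebra_simps)
  then have "a\<^sup>2 * Q q * ((E q)\<^sup>2 * r q) = r q" by (simp add: algebra_simps)
  then show "snd (N q) $ 1 = - fst (N q) * P1 q" "snd (N q) $ 2 = - fst (N q) * P2 q"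
    "(fst (N q))\<^sup>2 * Q q = r q" using n by (simp_all add: Nq E_r)
qed

text \<open>These are the differentials of the three identities in \<open>normal_components\<close>.
  The last one comes from \<open>a^2 * Q = r\<close> by cancelling \<open>a\<close>, which is
  nonzero because \<open>r\<close> is positive; no square root has to be chosen.\<close>

lemma normal_derivative:
  assumes N: "unit_normal_field (warped_metric f) (graph_map u) U N" and q: "q \<in> U"
  defines "a \<equiv> fst (N q)" and "dN \<equiv> frechet_derivative N (at q)"
  shows "snd (dN v) $ 1 = - (fst (dN v) * P1 q + a * ((b11 q - s q) * v$1 + b12 q * v$2))"
    "snd (dN v) $ 2 = - (fst (dN v) * P2 q + a * (b12 q * v$1 + (b22 q - s q) * v$2))"
    "Q q * (fst (dN v) - s q * (E q)\<^sup>2 * a * (P1 q * v$1 + P2 q * v$2)) = - a * (W1 q * v$1 + W2 q * v$2)"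
proof -
  have "N differentiable (at q)"
    using N q unfolding unit_normal_field_def by (auto intro: smooth_on_differentiable)
  then have dN: "(N has_derivative dN) (at q)" unfolding dN_def by (simp add: frechet_derivative_works)
  have dfst: "((\<lambda>z. fst (N z)) has_derivative (\<lambda>v. fst (dN v))) (at q)"
    by (rule has_derivative_fst[OF dN])
  have dsnd: "((\<lambda>z. snd (N z) $ i) has_derivative (\<lambda>v. snd (dN v) $ i)) (at q)" for i
    by (rule bounded_linear.has_derivative[OF bounded_linear_vec_nth has_derivative_snd[OF dN]])
  \<comment> \<open>Functions that agree on the open set \<open>U\<close> have equal derivatives at
    \<open>q\<close>.\<close>
  have tr: "D = D'" if "(F has_derivative D) (at q)" "(G has_derivative D') (at q)" "\<And>z. z \<in> U \<Longrightarrow> F z = G z"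
    for F G :: "real^2 \<Rightarrow> real" and D D'
    using has_derivative_transform_within_open[OF that(2) U_open q] that
    by (metis (no_types, lifting) has_derivative_unique)
  have "(\<lambda>v. snd (dN v) $ 1) = (\<lambda>v. - (a * ((b11 q - s q) * v$1 + b12 q * v$2) + fst (dN v) * P1 q))"
    unfolding a_def
    by (rule tr[OF dsnd has_derivative_minus[OF has_derivative_mult[OF dfst grad_P1[OF q]]]])
      (simp add: normal_components[OF N])
  from fun_cong[OF this, of v]
  show "snd (dN v) $ 1 = - (fst (dN v) * P1 q + a * ((b11 q - s q) * v$1 + b12 q * v$2))" by simp
  have "(\<lambda>v. snd (dN v) $ 2) = (\<lambda>v. - (a * (b12 q * v$1 + (b22 q - s q) * v$2) + fst (dN v) * P2 q))"
    unfolding a_def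
    by (rule tr[OF dsnd has_derivative_minus[OF has_derivative_mult[OF dfst grad_P2[OF q]]]])
      (simp add: normal_components[OF N])
  from fun_cong[OF this, of v]
  show "snd (dN v) $ 2 = - (fst (dN v) * P2 q + a * (b12 q * v$1 + (b22 q - s q) * v$2))" by simp
  have "(\<lambda>v. (a * a) * (2 * W1 q * v$1 + 2 * W2 q * v$2) + (a * fst (dN v) + fst (dN v) * a) * Q q)
      = (\<lambda>v. 2 * s q * P1 q * v$1 + 2 * s q * P2 q * v$2)"
    unfolding a_def
    by (rule tr[OF has_derivative_mult[OF has_derivative_mult[OF dfst dfst] grad_Q[OF q]] grad_r[OF q]])
      (metis normal_components(3)[OF N] power2_eq_square)
  from fun_cong[OF this, of v]
  have "a * (a * (W1 q * v$1 + W2 q * v$2) + fst (dN v) * Q q) = s q * (P1 q * v$1 + P2 q * v$2)"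
    by (simp add: algebra_simps)
  also have "\<dots> = a * (a * Q q) * (E q)\<^sup>2 * s q * (P1 q * v$1 + P2 q * v$2)"
    using normal_components(3)[OF N q] E_r[of q] by (simp add: a_def power2_eq_square mult_ac)
  finally have "a * (a * (W1 q * v$1 + W2 q * v$2) + fst (dN v) * Q q)
      = a * (a * Q q * (E q)\<^sup>2 * s q * (P1 q * v$1 + P2 q * v$2))" by (simp add: mult_ac)
  moreover have "a \<noteq> 0" using normal_components(3)[OF N q] r_pos[of q] by (auto simp: a_def)
  ultimately have "a * (W1 q * v$1 + W2 q * v$2) + fst (dN v) * Q q
      = a * Q q * (E q)\<^sup>2 * s q * (P1 q * v$1 + P2 q * v$2)" by simp
  then show "Q q * (fst (dN v) - s q * (E q)\<^sup>2 * a * (P1 q * v$1 + P2 q * v$2)) = - a * (W1 q * v$1 + W2 q * v$2)"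
    by (simp add: algebra_simps)
qed

text \<open>The shape operator has the matrix \<open>A = a (I - P P^T / Q) b\<close>. Because
  \<open>Q\<close> minus the squared length of \<open>P\<close> is \<open>r\<close>, its determinant
  is \<open>a^2 * r / Q\<close> times that of \<open>b\<close>; then \<open>a^2 * Q = r\<close> and
  \<open>E^2 * r = 1\<close> remove \<open>a\<close> and \<open>r\<close>.\<close>

lemma extrinsic_curvature_graph:
  assumes N: "unit_normal_field (warped_metric f) (graph_map u) U N" and q: "q \<in> U"
  shows "extrinsic_curvature (warped_metric f) (graph_map u) N q * (Q q)\<^sup>2 * E q ^ 4
    = b11 q * b22 q - (b12 q)\<^sup>2"
proof -
  define a where "a = fst (N q)"
  define dN where "dN = frechet_derivative N (at q)"
  define A :: "real^2^2" where "A = vector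
    [vector [a * b11 q - a * W1 q * P1 q / Q q, a * b12 q - a * W2 q * P1 q / Q q],
     vector [a * b12 q - a * W1 q * P2 q / Q q, a * b22 q - a * W2 q * P2 q / Q q]]"
  have A: "A$1$1 = a * b11 q - a * W1 q * P1 q / Q q" "A$1$2 = a * b12 q - a * W2 q * P1 q / Q q"
    "A$2$1 = a * b12 q - a * W1 q * P2 q / Q q" "A$2$2 = a * b22 q - a * W2 q * P2 q / Q q"
    by (simp_all add: A_def)
  note nd = normal_derivative[OF N q, folded a_def dN_def]
  note nc = normal_components[OF N q, folded a_def]
  have fdiff: "f differentiable (at t)" for t
    using DERIV_f by (meson real_differentiable_def)
  have cov: "cov_deriv_along (warped_metric f) (graph_map u) N q v
      = - ((E q)\<^sup>2 * (P1 q * (A *v v)$1 + P2 q * (A *v v)$2), A *v v)" for v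
  proof -
    define pv where "pv = P1 q * v$1 + P2 q * v$2"
    define wv where "wv = W1 q * v$1 + W2 q * v$2"
    have Nq: "N q = (a, snd (N q))" by (simp add: a_def)
    have vn: "v \<bullet> snd (N q) = - a * pv"
      by (simp add: inner_vec_def sum_2 nc pv_def algebra_simps)
    have beta: "fst (dN v) - s q * (E q)\<^sup>2 * a * pv = - a * wv / Q q"
      using nd(3)[of v] Q_pos[of q] by (simp add: pv_def wv_def field_simps)
    have cov: "cov_deriv_along (warped_metric f) (graph_map u) N q v
      = (fst (dN v) + s q * (E q)\<^sup>2 * (v \<bullet> snd (N q)),
         snd (dN v) - s q *\<^sub>R (((E q)\<^sup>2 * pv) *\<^sub>R snd (N q) + a *\<^sub>R v))"
      unfolding cov_deriv_along_def levi_civita_warped[OF fdiff] graph_map_derivative[OF q]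
      apply (subst Nq)
      by (simp add: graph_map_def exp_2f dN_def[symmetric] s_def pv_def prod_eq_iff)
    have Av1: "(A *v v)$1 = a * (b11 q * v$1 + b12 q * v$2) - a * wv / Q q * P1 q"
      and Av2: "(A *v v)$2 = a * (b12 q * v$1 + b22 q * v$2) - a * wv / Q q * P2 q"
      using Q_pos[of q] by (simp_all add: matrix_vector_mult_def sum_2 A wv_def field_simps)
    define k where "k = a * wv / Q q"
    note Av1 = Av1[folded k_def] and Av2 = Av2[folded k_def]
    have dn: "fst (dN v) = s q * (E q)\<^sup>2 * a * pv - a * wv / Q q" using beta by simp
    \<comment> \<open>The first component must be the one that tangency to the graph prescribes for
      the planar part \<open>- (A *v v)\<close>.\<close>
    have "fst (dN v) + s q * (E q)\<^sup>2 * (v \<bullet> snd (N q)) = - a * wv / Q q"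
      unfolding vn dn by simp
    also have "\<dots> = - ((E q)\<^sup>2 * (P1 q * (A *v v)$1 + P2 q * (A *v v)$2))"
    proof -
      have "P1 q * (A *v v)$1 + P2 q * (A *v v)$2 = a * wv - k * ((P1 q)\<^sup>2 + (P2 q)\<^sup>2)"
        unfolding Av1 Av2 wv_def W1_def W2_def by (simp add: algebra_simps power2_eq_square)
      also have "\<dots> = a * wv / Q q * r q"
        using Q_pos[of q] by (simp add: k_def field_simps) (simp add: Q_def algebra_simps)
      finally have e: "P1 q * (A *v v)$1 + P2 q * (A *v v)$2 = a * wv / Q q * r q" .
      have "(E q)\<^sup>2 * (a * wv / Q q * r q) = a * wv / Q q * ((E q)\<^sup>2 * r q)" by (simp only: mult_ac)
      then show ?thesis unfolding e E_r by simp
    qed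
    finally have c1: "fst (dN v) + s q * (E q)\<^sup>2 * (v \<bullet> snd (N q))
        = - ((E q)\<^sup>2 * (P1 q * (A *v v)$1 + P2 q * (A *v v)$2))" .
    have c2: "snd (dN v) - s q *\<^sub>R (((E q)\<^sup>2 * pv) *\<^sub>R snd (N q) + a *\<^sub>R v) = - (A *v v)"
      unfolding vec_eq_iff forall_2
      by (simp add: nd(1,2) nc Av1 Av2 dn k_def[symmetric] algebra_simps)
    show ?thesis unfolding cov c1 c2 by simp
  qed
  have "shape_operator (warped_metric f) (graph_map u) N q = (\<lambda>v. A *v v)"
    unfolding shape_operator_def
  proof (rule the_equality)
    show "linear ((*v) A) \<and> (\<forall>v. cov_deriv_along (warped_metric f) (graph_map u) N q v
        = - frechet_derivative (graph_map u) (at q) (A *v v))"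
      using cov by (simp add: graph_map_derivative[OF q])
  next
    fix S assume S: "linear S \<and> (\<forall>v. cov_deriv_along (warped_metric f) (graph_map u) N q v
        = - frechet_derivative (graph_map u) (at q) (S v))"
    \<comment> \<open>The planar component of the differential of the graph map is the identity, so
      \<open>S v\<close> can be read off.\<close>
    show "S = (*v) A"
    proof
      fix v
      show "S v = A *v v" using S cov[of v] by (simp add: graph_map_derivative[OF q])
    qed
  qed
  then have "extrinsic_curvature (warped_metric f) (graph_map u) N q = det A"
    by (simp add: extrinsic_curvature_def)
  also have "\<dots> = a\<^sup>2 / Q q * (b11 q * b22 q - (b12 q)\<^sup>2) * (Q q - (P1 q)\<^sup>2 - (P2 q)\<^sup>2)"
    unfolding det_2 A W1_def W2_def using Q_pos[of q]
    by (simp add: field_simps) algebra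
  also have "Q q - (P1 q)\<^sup>2 - (P2 q)\<^sup>2 = r q" by (simp add: Q_def)
  also have "a\<^sup>2 / Q q * (b11 q * b22 q - (b12 q)\<^sup>2) * r q
      = (a\<^sup>2 * Q q) * (b11 q * b22 q - (b12 q)\<^sup>2) * r q / (Q q)\<^sup>2"
    using Q_pos[of q] by (simp add: power2_eq_square)
  finally have K: "extrinsic_curvature (warped_metric f) (graph_map u) N q
     = r q * (b11 q * b22 q - (b12 q)\<^sup>2) * r q / (Q q)\<^sup>2" unfolding nc(3) .
  have "E q ^ 4 = (E q)\<^sup>2 * (E q)\<^sup>2" by (simp flip: power_add)
  then have "extrinsic_curvature (warped_metric f) (graph_map u) N q * (Q q)\<^sup>2 * E q ^ 4
     = (b11 q * b22 q - (b12 q)\<^sup>2) * ((E q)\<^sup>2 * r q) * ((E q)\<^sup>2 * r q)"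
    unfolding K using Q_pos[of q] by simp
  then show ?thesis by (simp add: E_r)
qed

section \<open>The maximum principle for the test function\<close>

text \<open>The determinant equation is positive on the right, so \<open>b11 q < 0\<close> makes
  \<open>b\<close> negative definite at \<open>q\<close>. \<open>G\<close> enters the derivatives
  only through \<open>exp (f x)\<close>, which leaves its additive constant free.\<close>

lemma no_interior_maximum:
  assumes c: "c > 0" and lam: "0 < lam" "lam < 1"
    and f': "\<And>x. deriv f x \<le> 0" and f'': "\<And>x. deriv (deriv f) x \<ge> 0"
    and det: "\<And>z. z \<in> U \<Longrightarrow> b11 z * b22 z - (b12 z)\<^sup>2 = c\<^sup>2 * (Q z)\<^sup>2 * E z ^ 4"
    and q: "q \<in> U" and neg: "b11 q < 0" and sc: "s q \<le> c"
    and G: "\<And>x. DERIV G x :> exp (f x)"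
    and max: "\<And>z. z \<in> U \<Longrightarrow> lam * c * G (u z) - R z \<le> lam * c * G (u q) - R q"
  shows False
proof -
  have s0: "s q \<ge> 0" using f' by (simp add: s_def)
  have t0: "t q \<ge> 0" using f'' by (simp add: t_def)
  have grad: "has_gradient (\<lambda>z. lam * c * G (u z) - R z)
      (lam * c * E z ^ 3 * P1 z + R z ^ 3 * W1 z) (lam * c * E z ^ 3 * P2 z + R z ^ 3 * W2 z) z"
    if z: "z \<in> U" for z
    by (rule has_gradient_cong[OF has_gradient_diff[OF has_gradient_mult[OF has_gradient_const[of "lam * c"]
            has_gradient_compose[OF grad_u[OF z] G]] grad_R[OF z]]])
      (simp_all add: u1_eq u2_eq E_def[symmetric] power2_eq_square power3_eq_cube)
  have lhs: "has_gradient (\<lambda>z. b11 z * b22 z - (b12 z)\<^sup>2)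
      ((p111 q - t q * P1 q) * b22 q + b11 q * (p122 q - t q * P1 q) - 2 * b12 q * p112 q)
      ((p112 q - t q * P2 q) * b22 q + b11 q * (p222 q - t q * P2 q) - 2 * b12 q * p122 q) q"
    by (rule has_gradient_cong[OF has_gradient_diff[OF has_gradient_mult[OF grad_b11[OF q] grad_b22[OF q]]
            has_gradient_power[OF grad_b12[OF q]]]]) simp_all
  have "has_gradient (\<lambda>z. c\<^sup>2 * (Q z)\<^sup>2 * E z ^ 4)
      (c\<^sup>2 * (4 * Q q * W1 q * E q ^ 4 - 4 * s q * E q ^ 6 * P1 q * (Q q)\<^sup>2))
      (c\<^sup>2 * (4 * Q q * W2 q * E q ^ 4 - 4 * s q * E q ^ 6 * P2 q * (Q q)\<^sup>2)) q"
    by (rule has_gradient_cong[OF has_gradient_mult[OF has_gradient_mult[OF has_gradient_const[of "c\<^sup>2"]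
            has_gradient_power[OF grad_Q[OF q]]] has_gradient_power[OF grad_E[OF q]]]])
      (simp_all add: eval_nat_numeral algebra_simps)
  \<comment> \<open>Both gradients belong to the same function on \<open>U\<close>; equating
    coefficients gives the differentiated curvature equation.\<close>
  note d = has_gradient_unique[OF lhs has_gradient_transform[OF U_open q det this]]
  note test = second_derivative_test[OF U_open q max grad grad_first[OF q] grad_second[OF q]]
  show False
    by (rule no_second_order_maximum[OF c lam s0 sc t0 E_pos R_pos R_Q Q_E det[OF q] neg W1_def W2_def d
          test(1,2) refl refl refl refl test(3)])
qed

end

section \<open>Convexity of \<open>f\<close> and the height estimate\<close>

lemma convex_tangent_at_zero:
  fixes f :: "real \<Rightarrow> real"
  assumes f: "\<And>x. DERIV f x :> f' x" and mono: "\<And>x y. x \<le> y \<Longrightarrow> f' x \<le> f' y" and "x \<ge> 0"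
  shows "f 0 \<ge> f x - f' x * x"
proof (cases "x = 0")
  case False
  then have "0 < x" using assms(3) by simp
  from MVT2[OF this, of f f'] f obtain z where z: "z < x" "f x - f 0 = x * f' z" by auto
  have "x * f' z \<le> x * f' x" using mono[of z x] z(1) \<open>0 < x\<close> by (intro mult_left_mono) auto
  then show ?thesis using z(2) by (simp add: mult.commute)
qed simp

theorem theorem1p1:
  fixes f :: "real \<Rightarrow> real" and D :: "(real^2) set" and u :: "real^2 \<Rightarrow> real"
    and N :: "real^2 \<Rightarrow> real \<times> (real^2)" and Ke :: real
  assumes "smooth_on UNIV f"
    and "\<forall>t. f t \<ge> 0"
    and "\<forall>t. deriv f t \<le> 0"
    and "\<forall>t. deriv (deriv f) t \<ge> 0"
    and "compact_graph D u"
    and "unit_normal_field (warped_metric f) (graph_map u) (interior D) N"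
    and "Ke > 0"
    and "\<forall>q\<in>interior D. extrinsic_curvature (warped_metric f) (graph_map u) N q = Ke"
    and "graph_boundary D u \<subseteq> {0} \<times> UNIV"
  shows "\<forall>p\<in>graph_map u ` D. height p \<le> exp (f 0) / sqrt Ke"
proof (rule ccontr)
  assume "\<not> ?thesis"
  then obtain q where q: "q \<in> D" "u q > exp (f 0) / sqrt Ke"
    by (auto simp: height_def graph_map_def not_le)
  define c where "c = sqrt Ke"
  have c: "c > 0" "c\<^sup>2 = Ke" using \<open>Ke > 0\<close> by (simp_all add: c_def)
  define U where "U = interior D"
  have conn: "connected U" and cont: "continuous_on D u" and smooth: "smooth_on U u"
    and cg: "compact (graph_map u ` D)"
    using assms(5) unfolding compact_graph_def U_def by auto
  have "snd ` (graph_map u ` D) = D" by (force simp: graph_map_def image_image)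
  then have comp: "compact D"
    using compact_continuous_image[OF continuous_on_snd[OF continuous_on_id] cg] by simp
  then have DU: "D = U \<union> frontier D"
    using compact_imp_closed[OF comp] interior_subset[of D] by (auto simp: U_def frontier_def)
  have bdry: "u z = 0" if "z \<in> frontier D" for z
    using assms(9) that by (auto simp: graph_boundary_def graph_map_def)
  interpret warped_graph f U u
    by unfold_locales (use assms(1) smooth in \<open>auto simp: U_def\<close>)
  have det: "b11 z * b22 z - (b12 z)\<^sup>2 = c\<^sup>2 * (Q z)\<^sup>2 * E z ^ 4" if "z \<in> U" for z
    using extrinsic_curvature_graph[of N z] assms(6,8) that by (simp add: U_def c)
  obtain q0 where q0: "q0 \<in> D" "\<And>z. z \<in> D \<Longrightarrow> u z \<le> u q0"
    using continuous_attains_sup[OF comp _ cont] q(1) by auto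
  define m where "m = u q0"
  have cm: "exp (f 0) < c * m"
  proof -
    have "exp (f 0) < c * u q" using q(2) c(1) by (simp add: c_def[symmetric] field_simps)
    also have "\<dots> \<le> c * m" unfolding m_def by (rule mult_left_mono[OF q0(2)[OF q(1)]]) (use c in simp)
    finally show ?thesis .
  qed
  then have "0 < c * m" by (meson exp_gt_zero less_trans)
  then have m: "m > 0" using c(1) by (simp add: zero_less_mult_iff)
  have q0U: "q0 \<in> U" using q0(1) DU bdry m by (auto simp: m_def)
  have mono: "deriv f x \<le> deriv f y" if "x \<le> y" for x y
    by (rule DERIV_nonneg_imp_nondecreasing[OF that]) (use DERIV_deriv_f assms(4) in blast)
  have anti: "f y \<le> f x" if "x \<le> y" for x y
    by (rule DERIV_nonpos_imp_nonincreasing[OF that]) (use DERIV_f assms(3) in blast)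
  have tangent: "f 0 \<ge> f x - deriv f x * x" if "x \<ge> 0" for x
    using DERIV_f mono that by (rule convex_tangent_at_zero)
  \<comment> \<open>The tangent of \<open>f\<close> at \<open>x\<close>, evaluated at 0, together
    with \<open>f \<ge> 0\<close> gives \<open>c * x \<le> f 0\<close>. This serves twice: it
    excludes such a slope at the maximal height, and it bounds \<open>t0\<close>.\<close>
  have high: "exp (f 0) \<ge> 1 + c * x" if "x \<ge> 0" "- deriv f x \<ge> c" for x
  proof -
    have "c * x \<le> - deriv f x * x" by (rule mult_right_mono[OF that(2,1)])
    also have "\<dots> \<le> f 0" using tangent[OF that(1)] assms(2)[rule_format, of x] by linarith
    finally show ?thesis using exp_ge_add_one_self[of "f 0"] by linarith
  qed
  have sm: "s q0 < c" using high[of m] m cm by (force simp: s_def m_def)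
  have umax: "u z \<le> u q0" if "z \<in> U" for z using q0(2) that DU by blast
  note u_test = second_derivative_test[OF U_open q0U umax grad_u grad_u1[OF q0U] grad_u2[OF q0U]]
  have P0: "P1 q0 = 0" "P2 q0 = 0" by (simp_all add: P1_def P2_def u_test)
  \<comment> \<open>At the top the Hessian of \<open>u\<close> bounds both diagonal entries of
    \<open>b\<close> by \<open>s q0 < c\<close>. If \<open>b11\<close> were not negative, both
    entries would be positive with product below \<open>c^2\<close>, while the determinant equation
    makes the product at least \<open>c^2\<close>.\<close>
  have neg0: "b11 q0 < 0"
  proof (rule ccontr)
    assume b: "\<not> b11 q0 < 0"
    have "u11 q0 \<le> 0" "u22 q0 \<le> 0" using u_test(3)[of 1 0] u_test(3)[of 0 1] by simp_all
    then have le: "b11 q0 \<le> s q0" "b22 q0 \<le> s q0"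
      using r_pos[of q0] by (simp_all add: b11_def b22_def P0 mult_nonneg_nonpos)
    have "(Q q0)\<^sup>2 * E q0 ^ 4 = (Q q0 * (E q0)\<^sup>2)\<^sup>2" by (simp add: power_mult_distrib flip: power_mult)
    also have "\<dots> = 1" by (simp add: Q_E P0)
    finally have "b11 q0 * b22 q0 = c\<^sup>2 + (b12 q0)\<^sup>2" using det[OF q0U] by (simp add: mult.assoc)
    then have ge: "b11 q0 * b22 q0 \<ge> c\<^sup>2" by simp
    then have "b11 q0 * b22 q0 > 0" using c(1) by (smt (verit) zero_less_power)
    then have pos: "b11 q0 > 0" "b22 q0 > 0" using b by (auto simp: zero_less_mult_iff)
    then have "b11 q0 * b22 q0 \<le> s q0 * s q0" using le by (intro mult_mono) auto
    also have "\<dots> < c * c" using sm pos le by (intro mult_strict_mono) auto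
    finally show False using ge by (simp add: power2_eq_square)
  qed
  \<comment> \<open>The determinant of \<open>b\<close> is positive, so \<open>b11\<close> cannot
    vanish, and its sign at the top persists on the connected set \<open>U\<close>.\<close>
  have neg: "b11 z < 0" if z: "z \<in> U" for z
  proof (rule ccontr)
    assume "\<not> b11 z < 0"
    have "continuous_on U b11"
      using has_derivative_continuous[OF grad_b11] by (intro continuous_at_imp_continuous_on ballI)
    then have "connected (b11 ` U)" using conn by (rule connected_continuous_image)
    from connected_contains_Icc[OF this, of "b11 q0" "b11 z"] q0U z
    have "{b11 q0..b11 z} \<subseteq> b11 ` U" by auto
    moreover have "0 \<in> {b11 q0..b11 z}" using neg0 \<open>\<not> b11 z < 0\<close> by simp
    ultimately obtain y where y: "y \<in> U" "b11 y = 0" by force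
    have "c\<^sup>2 * (Q y)\<^sup>2 * E y ^ 4 > 0" using c(1) Q_pos[of y] E_pos[of y] by simp
    moreover have "- (b12 y)\<^sup>2 = c\<^sup>2 * (Q y)\<^sup>2 * E y ^ 4" using det[OF y(1)] y(2) by simp
    ultimately show False using zero_le_power2[of "b12 y"] by linarith
  qed
  \<comment> \<open>As \<open>deriv f\<close> is nondecreasing, the slope condition of the maximum
    principle holds at every height from \<open>t0\<close> upwards. The second case uses the
    intermediate value theorem between 0 and \<open>m\<close>.\<close>
  obtain t0 where t0: "t0 \<ge> 0" "t0 \<le> m" "- deriv f t0 \<le> c" "exp (f 0) \<ge> 1 + c * t0"
  proof (cases "- deriv f 0 \<le> c")
    case True
    have "exp (f 0) \<ge> 1 + c * 0" using assms(2) by simp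
    with True m that[of 0] show thesis by simp
  next
    case False
    have "\<exists>x\<ge>0. x \<le> m \<and> deriv f x = - c"
    proof (rule IVT')
      show "continuous_on {0..m} (deriv f)"
        using DERIV_isCont[OF DERIV_deriv_f] by (intro continuous_at_imp_continuous_on ballI)
    qed (use False sm m in \<open>auto simp: s_def m_def\<close>)
    then obtain x where "x \<ge> 0" "x \<le> m" "deriv f x = - c" by blast
    with high[of x] that[of x] show thesis by simp
  qed
  have "\<exists>G. \<forall>x. DERIV G x :> exp (f x)"
    using einterval_antiderivative[of "-\<infinity>" "\<infinity>" "\<lambda>x. exp (f x)"] DERIV_isCont[OF DERIV_f]
    by (auto simp: has_real_derivative_iff_has_vector_derivative intro!: continuous_intros)
  then obtain G0 where G0: "\<And>x. DERIV G0 x :> exp (f x)" by blast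
  \<comment> \<open>Normalising at \<open>t0\<close> makes \<open>G\<close> nonpositive at all
    heights up to \<open>t0\<close>, in particular at the height 0 of the boundary.\<close>
  define G where "G x = G0 x - G0 t0" for x
  have G: "DERIV G x :> exp (f x)" for x
    unfolding G_def by (auto intro!: derivative_eq_intros G0)
  have Gmono: "G x \<le> G y" if "x \<le> y" for x y
    by (rule DERIV_nonneg_imp_nondecreasing[OF that]) (use G in \<open>force intro: less_imp_le\<close>)
  have Gt0: "G t0 = 0" by (simp add: G_def)
  \<comment> \<open>\<open>G m\<close> is the integral of the decreasing function
    \<open>exp (f x)\<close> from \<open>t0\<close> to \<open>m\<close>, hence at least the length
    times the last value.\<close>
  have Gm: "G m \<ge> (m - t0) * exp (f m)"
  proof (cases "t0 = m")
    case False
    then have "t0 < m" using t0 by simp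
    from MVT2[OF this, of G "\<lambda>x. exp (f x)"] G
    obtain z where z: "z < m" "G m - G t0 = (m - t0) * exp (f z)" by auto
    have "(m - t0) * exp (f m) \<le> (m - t0) * exp (f z)"
      using anti[of z m] z(1) t0 by (intro mult_left_mono) auto
    then show ?thesis using z Gt0 by simp
  qed (use Gt0 in simp)
  have main: "lam * (c * (m - t0)) \<le> 1" if lam: "0 < lam" "lam < 1" for lam
  proof -
    define F where "F z = lam * c * G (u z) - R z" for z
    have "F q0 \<le> 0"
    proof (rule ccontr)
      assume "\<not> F q0 \<le> 0"
      then have Fpos: "F q0 > 0" by simp
      \<comment> \<open>\<open>R\<close> is controlled only over the interior, so \<open>F\<close>
        cannot be maximised over \<open>D\<close> directly. Since \<open>R > 0\<close>, every point
        of \<open>U\<close> outside \<open>B\<close> has \<open>F z < F q0\<close>. Positivity of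
        \<open>G\<close> on \<open>B\<close> keeps the compact set \<open>B\<close> away from the
        frontier, so a maximum over \<open>B\<close> is one over \<open>U\<close>.\<close>
      define B where "B = {z \<in> D. F q0 \<le> lam * c * G (u z)}"
      have contG: "continuous_on A G" for A
        using DERIV_isCont[OF G] by (intro continuous_at_imp_continuous_on ballI)
      have contGu: "continuous_on D (\<lambda>z. lam * c * G (u z))"
        by (intro continuous_intros continuous_on_compose2[OF contG[of UNIV] cont]) auto
      have "B = D \<inter> (\<lambda>z. lam * c * G (u z)) -` {F q0..}" by (auto simp: B_def)
      then have "closed B"
        using continuous_closed_preimage[OF contGu compact_imp_closed[OF comp], of "{F q0..}"] by simp
      moreover have "B \<subseteq> D" by (auto simp: B_def)
      ultimately have compB: "compact B" using comp by (metis compact_Int_closed inf.absorb_iff2)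
      have Gpos: "G (u z) > 0" if "z \<in> B" for z
      proof -
        have "lam * c * G (u z) > 0" using that Fpos by (simp add: B_def)
        moreover have "lam * c > 0" using lam c(1) by simp
        ultimately show ?thesis by (rule zero_less_mult_pos)
      qed
      have BU: "z \<in> U" if "z \<in> B" for z
        using Gpos[OF that] Gmono[OF t0(1)] Gt0 bdry[of z] DU that by (force simp: B_def)
      have q0B: "q0 \<in> B" using q0(1) R_pos[of q0] by (simp add: B_def F_def)
      have "continuous_on B R"
          using has_derivative_continuous[OF grad_R[OF BU]] by (intro continuous_at_imp_continuous_on ballI)
      then have "continuous_on B F"
        unfolding F_def by (intro continuous_intros continuous_on_subset[OF contGu]) (auto simp: B_def)
      then obtain q1 where q1: "q1 \<in> B" "\<And>z. z \<in> B \<Longrightarrow> F z \<le> F q1"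
        using continuous_attains_sup[OF compB] q0B by blast
      have max: "F z \<le> F q1" if "z \<in> U" for z
      proof (cases "z \<in> B")
        case False
        then have "lam * c * G (u z) < F q0" using that DU by (auto simp: B_def)
        then have "F z < F q0" using R_pos[of z] by (simp add: F_def)
        then show ?thesis using q1(2)[OF q0B] by simp
      qed (use q1 in blast)
      \<comment> \<open>Positivity of \<open>G\<close> places the maximum point at or above
        \<open>t0\<close>, where the slope condition holds.\<close>
      have "t0 \<le> u q1" using Gmono[of "u q1" t0] Gpos[OF q1(1)] Gt0 by linarith
      then have "s q1 \<le> c" using mono[of t0 "u q1"] t0(3) by (simp add: s_def)
      then show False
        using no_interior_maximum[OF c(1) lam _ _ det BU[OF q1(1)] neg[OF BU[OF q1(1)]] _ G]
          assms(3,4) max unfolding F_def by blast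
    qed
    then have "lam * c * G m \<le> R q0" by (simp add: F_def m_def)
    \<comment> \<open>The tangent plane at the top is horizontal, so the absolute value of \<nu> is
      1 there.\<close>
    also have "R q0 = exp (f m)"
    proof -
      have "Q q0 = inverse ((E q0)\<^sup>2)" using Q_E[of q0] E_pos[of q0] by (simp add: P0 field_simps)
      then show ?thesis using E_pos[of q0] by (simp add: R_def real_sqrt_inverse E_def m_def)
    qed
    finally have "lam * c * G m \<le> exp (f m)" .
    moreover have "lam * c * ((m - t0) * exp (f m)) \<le> lam * c * G m"
      using Gm lam c(1) by (intro mult_left_mono) auto
    ultimately have "lam * c * ((m - t0) * exp (f m)) \<le> exp (f m)" by linarith
    then have "(lam * (c * (m - t0))) * exp (f m) \<le> 1 * exp (f m)" by (simp only: mult_ac mult_1)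
    then show ?thesis by (rule mult_right_le_imp_le) simp
  qed
  define x where "x = c * (m - t0)"
  have "x > 1" using cm t0(4) by (simp add: x_def algebra_simps)
  \<comment> \<open>In place of a limit, \<open>main\<close> is applied to the midpoint of
    \<open>1 / x\<close> and 1; multiplied by \<open>x\<close> it gives \<open>(x + 1) / 2\<close>,
    which exceeds 1.\<close>
  then obtain y where y: "0 < y" "y < 1" "y * x = 1" by (intro that[of "1 / x"]) auto
  then have "(1 + y) / 2 * x \<le> 1" unfolding x_def by (intro main) auto
  moreover have "(1 + y) / 2 * x = (x + y * x) / 2" by (simp add: algebra_simps)
  ultimately show False using \<open>x > 1\<close> y(3) by simp
qed

end
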